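(* Let $\mathcal A$ be a finite alphabet, let $\varphi:\mathcal A^*\to\mathcal A^*$ be a primitive marked morphism, and let ${\bf u}\in\mathcal A^{\mathbb N}$ be a fixed point of $\varphi$ with $D({\bf u})<+\infty$. If all complete return words to all letters in ${\bf u}$ are palindromes, or if there exists a conjugate of $\varphi$ distinct from $\varphi$ itself, then $D({\bf u})=0$.
   Context: For a finite word $w$, $\widetilde w$ denotes its reversal; $w$ is a palindrome if $w=\widetilde w$. The palindromic defect of a finite word $w$ of length $n$ is $D(w)=n+1-(\text{number of distinct palindromic factors of } w$, the empty word included$)$. For an infinite word ${\bf u}$, $D({\bf u})=\sup\{D(w): w \text{ a factor of } {\bf u}\}$. A morphism $\varphi$ is primitive if there is $k$ such that every letter $b$ occurs in $\varphi^k(a)$ for every letter $a$. A fixed point of $\varphi$ is an infinite word ${\bf u}$ with $\varphi({\bf u})={\bf u}$. If $i<j$ are two consecutive occurrences of a factor $w=u_i\cdots u_{i+|w|-1}$ in ${\bf u}=u_0u_1\cdots$, then $u_iu_{i+1}\cdots u_{j+|w|-1}$ is a complete return word to $w$ in ${\bf u}$. A morphism $\psi$ is a left conjugate of $\varphi$ (and $\varphi$ a right conjugate of $\psi$), written $\psi\triangleright\varphi$, if there is $w\in\mathcal A^*$ with $\varphi(a)w=w\psi(a)$ for all $a\in\mathcal A$; a conjugate of $\varphi$ is any left or right conjugate of $\varphi$. A morphism is cyclic if there is $w$ with $\varphi(a)\in w^*$ for all letters $a$, and acyclic otherwise. For an acyclic morphism $\varphi$, its leftmost conjugate $\varphi_L$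 is the left conjugate $\psi$ of $\varphi$ for which the map $\textsc{Fst}(\psi):a\mapsto$ first letter of $\psi(a)$ is not constant, and its rightmost conjugate $\varphi_R$ is the right conjugate $\psi$ of $\varphi$ for which the map $\textsc{Lst}(\psi):a\mapsto$ last letter of $\psi(a)$ is not constant. An acyclic morphism $\varphi$ is marked if $\textsc{Fst}(\varphi_L)$ and $\textsc{Lst}(\varphi_R)$ are injective. *)

theory Defs
  imports Main "HOL-Library.Extended_Nat"
begin

type_synonym 'a morph = "'a \<Rightarrow> 'a list"

definition morph_app :: "'a morph \<Rightarrow> 'a list \<Rightarrow> 'a list" where
  "morph_app \<phi> w = concat (map \<phi> w)"

definition primitive :: "('a::finite) morph \<Rightarrow> bool" where
  "primitive \<phi> \<longleftrightarrow> (\<exists>k>0. \<forall>a b. b \<in> set ((morph_app \<phi> ^^ k) [a]))"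

definition pref :: "(nat \<Rightarrow> 'a) \<Rightarrow> nat \<Rightarrow> 'a list" where
  "pref u n = map u [0..<n]"

text \<open>Fixed point: phi(u) = u, i.e. phi of every prefix of u is a prefix of u
  (for non-erasing phi this is equivalent).\<close>
definition fixed_point :: "'a morph \<Rightarrow> (nat \<Rightarrow> 'a) \<Rightarrow> bool" where
  "fixed_point \<phi> u \<longleftrightarrow> (\<forall>n. \<forall>i < length (morph_app \<phi> (pref u n)). morph_app \<phi> (pref u n) ! i = u i)"

definition factors :: "'a list \<Rightarrow> 'a list set" where
  "factors w = {take m (drop i w) | i m. True}"

definition inf_factors :: "(nat \<Rightarrow> 'a) \<Rightarrow> 'a list set" where
  "inf_factors u = {map u [i..<i+n] | i n. True}"

definition palindrome :: "'a list \<Rightarrow> bool" where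
  "palindrome w \<longleftrightarrow> rev w = w"

text \<open>Palindromic defect of a finite word (empty word counted as a palindrome).\<close>
definition defect :: "'a list \<Rightarrow> nat" where
  "defect w = length w + 1 - card {v \<in> factors w. palindrome v}"

definition defect_inf :: "(nat \<Rightarrow> 'a) \<Rightarrow> enat" where
  "defect_inf u = (SUP w \<in> inf_factors u. enat (defect w))"

definition complete_return_words_letter :: "(nat \<Rightarrow> 'a) \<Rightarrow> 'a \<Rightarrow> 'a list set" where
  "complete_return_words_letter u a =
     {map u [i..<Suc j] | i j. i < j \<and> u i = a \<and> u j = a \<and> (\<forall>k. i < k \<and> k < j \<longrightarrow> u k \<noteq> a)}"

definition left_conj :: "'a morph \<Rightarrow> 'a morph \<Rightarrow> bool" where
  "left_conj \<psi> \<phi> \<longleftrightarrow> (\<exists>w. \<forall>a. \<phi> a @ w = w @ \<psi> a)"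

definition conjugate :: "'a morph \<Rightarrow> 'a morph \<Rightarrow> bool" where
  "conjugate \<psi> \<phi> \<longleftrightarrow> left_conj \<psi> \<phi> \<or> left_conj \<phi> \<psi>"

definition cyclic :: "'a morph \<Rightarrow> bool" where
  "cyclic \<phi> \<longleftrightarrow> (\<exists>w. \<forall>a. \<exists>k. \<phi> a = concat (replicate k w))"

definition Fst :: "'a morph \<Rightarrow> 'a \<Rightarrow> 'a" where
  "Fst \<psi> a = hd (\<psi> a)"

definition Lst :: "'a morph \<Rightarrow> 'a \<Rightarrow> 'a" where
  "Lst \<psi> a = last (\<psi> a)"

definition constant_map :: "('a \<Rightarrow> 'b) \<Rightarrow> bool" where
  "constant_map f \<longleftrightarrow> (\<exists>c. \<forall>x. f x = c)"

definition is_leftmost_conj :: "'a morph \<Rightarrow> 'a morph \<Rightarrow> bool" where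
  "is_leftmost_conj \<psi> \<phi> \<longleftrightarrow> left_conj \<psi> \<phi> \<and> \<not> constant_map (Fst \<psi>)"

definition is_rightmost_conj :: "'a morph \<Rightarrow> 'a morph \<Rightarrow> bool" where
  "is_rightmost_conj \<psi> \<phi> \<longleftrightarrow> left_conj \<phi> \<psi> \<and> \<not> constant_map (Lst \<psi>)"

definition marked :: "'a morph \<Rightarrow> bool" where
  "marked \<phi> \<longleftrightarrow> \<not> cyclic \<phi> \<and>
     (\<exists>\<psi>. is_leftmost_conj \<psi> \<phi> \<and> inj (Fst \<psi>)) \<and>
     (\<exists>\<psi>. is_rightmost_conj \<psi> \<phi> \<and> inj (Lst \<psi>))"

end

theory Submission
  imports Defs "HOL-Library.Infinite_Set"
begin

text \<open>Finite defect makes all complete returns to long factors (up to reversal) palindromic, and defect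
  zero means that this holds at every length. A shortest non-palindromic return \<open>x c a \<dots> b (rev c) x\<close>
  with \<open>a \<noteq> b\<close> yields a cycle in the graph of two-sided extensions of \<open>c\<close>, where \<open>c\<close> is nonempty if
  returns to letters are palindromic. With \<open>R\<close> and \<open>L\<close> the rightmost and leftmost conjugates of a power
  of the morphism and \<open>R a @ w = w @ L a\<close>, the map \<open>\<Phi> v = R(v) w\<close> preserves two-sided extensions because
  the morphism is marked, so it transports the cycle to arbitrarily long factors (\<open>w\<close> is nonempty if
  there is a second conjugate). But long factors have acyclic extension graphs.\<close>

section \<open>Palindromes and defect of finite words\<close>

text \<open>Acyclicity enters only in a weak form: the walk traced by the occurrences of a word and
  of its reversal always comes back to a vertex along the edge by which it left. Against this no
  genuine cycle has to be extracted from a non-palindromic return. A \<open>bad_walk\<close>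
  suffices: closed, meeting its start only at its two ends, with different neighbours of the start
  at the two ends. The power of the morphism serves to turn the permutations of last letters (for
  \<open>R\<close>) and of first letters (for \<open>L\<close>) into identities. Then
  \<open>x c y\<close> is mapped to a word containing \<open>x Phi(c) y\<close> with the same
  \<open>x\<close> and \<open>y\<close>, so the letters of the walk stay fixed and only its central
  word changes. The obstacle is reversal. The sides of the graph are identified exactly when the
  central word is a palindrome, and \<open>Phi\<close> need not commute with reversal, so an image
  may have a graph of the other kind. The two alternatives of the hypothesis are needed for growth:
  \<open>Phi\<close> fixes the empty word when \<open>w\<close> is empty, so \<open>c\<close> or
  \<open>w\<close> has to be nonempty.\<close>

lemma factors_iff: "v \<in> factors w \<longleftrightarrow> (\<exists>p s. w = p @ v @ s)"
proof
  assume "v \<in> factors w"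
  then obtain i m where "v = take m (drop i w)" by (auto simp: factors_def)
  then have "w = take i w @ v @ drop m (drop i w)"
    by (metis append_take_drop_id)
  then show "\<exists>p s. w = p @ v @ s" by blast
next
  assume "\<exists>p s. w = p @ v @ s"
  then obtain p s where "w = p @ v @ s" by blast
  then have "v = take (length v) (drop (length p) w)" by simp
  then show "v \<in> factors w" unfolding factors_def by blast
qed

lemma factors_trans: "x \<in> factors y \<Longrightarrow> y \<in> factors z \<Longrightarrow> x \<in> factors z"
  unfolding factors_iff by (metis append.assoc)

lemma finite_factors: "finite (factors w)"
proof (rule finite_subset)
  show "factors w \<subseteq> {v. set v \<subseteq> set w \<and> length v \<le> length w}"
    by (auto simp: factors_iff)
  show "finite {v. set v \<subseteq> set w \<and> length v \<le> length w}"
    by (rule finite_lists_length_le) simp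
qed

lemma factors_rev: "v \<in> factors (rev w) \<longleftrightarrow> rev v \<in> factors w"
  unfolding factors_iff by (metis append.assoc rev_append rev_rev_ident)

lemma factors_snoc: "v \<in> factors (w @ [a]) \<longleftrightarrow> v \<in> factors w \<or> (\<exists>p. w @ [a] = p @ v)"
proof
  assume "v \<in> factors (w @ [a])"
  then obtain p s where *: "w @ [a] = p @ v @ s" by (auto simp: factors_iff)
  show "v \<in> factors w \<or> (\<exists>p. w @ [a] = p @ v)"
  proof (cases s rule: rev_cases)
    case Nil
    then show ?thesis using * by auto
  next
    case (snoc s' b)
    then show ?thesis using * by (auto simp: factors_iff)
  qed
next
  assume "v \<in> factors w \<or> (\<exists>p. w @ [a] = p @ v)"
  then show "v \<in> factors (w @ [a])"
    unfolding factors_iff by (metis append.assoc append_Nil2)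
qed

section \<open>Counting palindromic factors letter by letter\<close>

definition pals :: "'a list \<Rightarrow> 'a list set" where
  "pals w = {v \<in> factors w. palindrome v}"

lemma finite_pals: "finite (pals w)"
  using finite_factors[of w] by (simp add: pals_def)

lemma pals_mono_snoc: "pals w \<subseteq> pals (w @ [a])"
  by (auto simp: pals_def factors_snoc)

text \<open>\<open>x\<close> is a suffix of the palindrome \<open>y\<close>, so it is also a prefix
  of \<open>y\<close>, and that copy ends before the last letter \<open>a\<close>.\<close>

lemma shorter_pal_suffix:
  assumes "palindrome x" "palindrome y" "w @ [a] = p @ y" "w @ [a] = q @ x" "length x < length y"
  shows "x \<in> factors w"
proof -
  have "p @ y = q @ x" using assms by simp
  then obtain z where z: "y = z @ x" using assms(5) by (auto simp: append_eq_append_conv2)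
  have "y = x @ rev z" using assms(1,2) z unfolding palindrome_def by (metis rev_append)
  moreover obtain z' b where "rev z = z' @ [b]"
    using z assms(5) by (cases "rev z" rule: rev_cases) auto
  ultimately have "w @ [a] = p @ x @ z' @ [b]" using assms by simp
  then show ?thesis by (auto simp: factors_iff)
qed

text \<open>A palindrome created by the last letter is a suffix, and of two palindromic suffixes the
  shorter has occurred before. So only the longest one can be new.\<close>

lemma new_pal_unique:
  assumes "x \<in> pals (w @ [a]) - pals w" "y \<in> pals (w @ [a]) - pals w"
  shows "x = y"
proof -
  have pal: "palindrome x" "palindrome y" and nf: "x \<notin> factors w" "y \<notin> factors w"
    using assms by (auto simp: pals_def)
  obtain p q where *: "w @ [a] = p @ x" "w @ [a] = q @ y"
    using assms nf by (auto simp: pals_def factors_snoc)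
  have "length x = length y"
    using shorter_pal_suffix[OF pal *(2,1)] shorter_pal_suffix[OF pal(2,1) *] nf
      linorder_neqE_nat by blast
  moreover have "p @ x = q @ y" using *(1)[symmetric] *(2) by (rule trans)
  ultimately show ?thesis by simp
qed

lemma card_pals_snoc:
  "card (pals (w @ [a])) = card (pals w) + (if pals (w @ [a]) = pals w then 0 else 1)"
proof (cases "pals (w @ [a]) = pals w")
  case False
  then obtain x where x: "x \<in> pals (w @ [a]) - pals w" using pals_mono_snoc[of w a] by blast
  have "pals (w @ [a]) = insert x (pals w)"
  proof
    show "pals (w @ [a]) \<subseteq> insert x (pals w)"
      using new_pal_unique[OF _ x] by auto
    show "insert x (pals w) \<subseteq> pals (w @ [a])"
      using x pals_mono_snoc[of w a] by blast
  qed
  moreover have "x \<notin> pals w" using x by blast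
  ultimately show ?thesis using False finite_pals[of w] by simp
qed simp

lemma pals_Nil: "pals [] = {[]}"
  by (auto simp: pals_def factors_iff palindrome_def)

text \<open>Makes the truncated subtraction in \<open>defect\<close> exact.\<close>

lemma card_pals_le: "card (pals w) \<le> length w + 1"
  by (induction w rule: rev_induct) (auto simp: card_pals_snoc pals_Nil)

lemma defect_eq: "defect w = length w + 1 - card (pals w)"
  by (simp add: defect_def pals_def)

lemma defect_snoc_le: "defect w \<le> defect (w @ [a])"
  using card_pals_snoc[of w a] by (auto simp: defect_eq)

text \<open>The length grows by one, so a constant defect forces a new palindrome, and a new
  palindrome is a suffix.\<close>

lemma defect_snoc_eq:
  assumes "defect (w @ [a]) = defect w"
  shows "\<exists>p q. palindrome q \<and> w @ [a] = p @ q \<and> q \<notin> factors w"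
proof -
  have "pals (w @ [a]) \<noteq> pals w"
    using assms card_pals_le[of w] by (auto simp: defect_eq)
  then obtain x where x: "x \<in> pals (w @ [a]) - pals w" using pals_mono_snoc[of w a] by blast
  then show ?thesis by (auto simp: pals_def factors_snoc)
qed

lemma defect_rev: "defect (rev w) = defect w"
proof -
  have "pals (rev w) = pals w"
    by (auto simp: pals_def factors_rev palindrome_def)
  then show ?thesis by (simp add: defect_eq)
qed

lemma defect_append_le: "defect w \<le> defect (w @ s)"
proof (induction s rule: rev_induct)
  case (snoc a s)
  then show ?case using defect_snoc_le[of "w @ s" a] by simp
qed simp

text \<open>Extension to the left reduces to extension to the right, since the defect is invariant
  under reversal.\<close>

lemma defect_factor_le:
  assumes "v \<in> factors w"
  shows "defect v \<le> defect w"
proof -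
  obtain p s where w: "w = p @ v @ s" using assms by (auto simp: factors_iff)
  have "defect v = defect (rev v)" by (simp add: defect_rev)
  also have "\<dots> \<le> defect (rev v @ rev p)" by (rule defect_append_le)
  also have "\<dots> = defect (p @ v)" using defect_rev[of "p @ v"] by simp
  also have "\<dots> \<le> defect (p @ v @ s)" using defect_append_le[of "p @ v" s] by simp
  finally show ?thesis using w by simp
qed

text \<open>If every prefix ends in a palindrome not seen before, each letter contributes one
  palindrome and the maximal count is reached.\<close>

lemma defect_zeroI:
  assumes "\<And>p a s. w = p @ [a] @ s \<Longrightarrow> \<exists>r q. palindrome q \<and> p @ [a] = r @ q \<and> q \<notin> factors p"
  shows "defect w = 0"
  using assms
proof (induction w rule: rev_induct)
  case Nil
  then show ?case by (simp add: defect_eq pals_Nil)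
next
  case (snoc a w)
  have "defect w = 0"
  proof (rule snoc.IH)
    fix p b s assume "w = p @ [b] @ s"
    then show "\<exists>r q. palindrome q \<and> p @ [b] = r @ q \<and> q \<notin> factors p"
      using snoc.prems[of p b "s @ [a]"] by simp
  qed
  moreover obtain r q where "palindrome q" "w @ [a] = r @ q" "q \<notin> factors w"
    using snoc.prems[of w a "[]"] unfolding append_Nil2 by blast
  then have "q \<in> pals (w @ [a])" "q \<notin> pals w"
    unfolding pals_def factors_snoc by blast+
  then have "pals (w @ [a]) \<noteq> pals w" by blast
  ultimately show ?case using card_pals_snoc[of w a] by (simp add: defect_eq)
qed

section \<open>Returns in infinite words\<close>

definition seg :: "(nat \<Rightarrow> 'a) \<Rightarrow> nat \<Rightarrow> nat \<Rightarrow> 'a list" where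
  "seg u i n = map u [i..<i + n]"

lemma length_seg [simp]: "length (seg u i n) = n"
  by (simp add: seg_def)

lemma nth_seg [simp]: "t < n \<Longrightarrow> seg u i n ! t = u (i + t)"
  by (simp add: seg_def)

lemma seg_0 [simp]: "seg u i 0 = []"
  by (simp add: seg_def)

lemma seg_Suc: "seg u i (Suc n) = u i # seg u (Suc i) n"
  by (simp add: seg_def upt_rec)

lemma seg_snoc: "seg u i (Suc n) = seg u i n @ [u (i + n)]"
  by (simp add: seg_def)

lemma seg_Suc_Suc: "seg u i (Suc (Suc n)) = u i # seg u (Suc i) n @ [u (Suc i + n)]"
  by (simp only: seg_Suc[of u i] seg_snoc[of u "Suc i"])

lemma seg_append: "seg u i (m + n) = seg u i m @ seg u (i + m) n"
  by (induction m arbitrary: i) (auto simp: seg_Suc)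

lemma seg_eq_iff: "seg u j n = seg u i n \<longleftrightarrow> (\<forall>t<n. u (j + t) = u (i + t))"
  by (auto simp: list_eq_iff_nth_eq)

lemma seg_eq_rev_iff: "seg u j n = rev (seg u i n) \<longleftrightarrow> (\<forall>t<n. u (j + t) = u (i + (n - 1 - t)))"
  by (auto simp: list_eq_iff_nth_eq rev_nth)

lemma palindrome_seg_iff:
  "palindrome (seg u i n) \<longleftrightarrow> (\<forall>t<n. u (i + t) = u (i + (n - 1 - t)))"
  unfolding palindrome_def using seg_eq_rev_iff[of u i n i] by auto

lemma inf_factors_iff: "v \<in> inf_factors u \<longleftrightarrow> (\<exists>i. v = seg u i (length v))"
proof
  assume "v \<in> inf_factors u"
  then obtain i n where "v = seg u i n" by (auto simp: inf_factors_def seg_def)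
  then show "\<exists>i. v = seg u i (length v)" by auto
next
  assume "\<exists>i. v = seg u i (length v)"
  then show "v \<in> inf_factors u" unfolding inf_factors_def seg_def by blast
qed

lemma seg_in_inf_factors [simp]: "seg u i n \<in> inf_factors u"
  unfolding inf_factors_iff by auto

lemma factors_seg:
  "v \<in> factors (seg u i m) \<longleftrightarrow> (\<exists>k\<ge>i. k + length v \<le> i + m \<and> v = seg u k (length v))"
proof
  assume "v \<in> factors (seg u i m)"
  then obtain p s where *: "seg u i m = p @ v @ s" by (auto simp: factors_iff)
  have len: "m = length p + length v + length s"
    using arg_cong[OF *, of length] by simp
  have "v = seg u (i + length p) (length v)"
  proof (rule nth_equalityI)
    fix t assume t: "t < length v"
    have "seg u i m ! (length p + t) = (p @ v @ s) ! (length p + t)" using * by simp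
    then show "v ! t = seg u (i + length p) (length v) ! t"
      using t len by (simp add: nth_append add.assoc)
  qed simp
  then show "\<exists>k\<ge>i. k + length v \<le> i + m \<and> v = seg u k (length v)"
    using len by (intro exI[of _ "i + length p"]) auto
next
  assume "\<exists>k\<ge>i. k + length v \<le> i + m \<and> v = seg u k (length v)"
  then obtain k where k: "k \<ge> i" "k + length v \<le> i + m" "v = seg u k (length v)" by blast
  define a b where "a = k - i" and "b = i + m - (k + length v)"
  have "m = a + (length v + b)" "k = i + a" using k by (auto simp: a_def b_def)
  then have "seg u i m = seg u i a @ v @ seg u (k + length v) b"
    using k(3) by (simp add: seg_append)
  then show "v \<in> factors (seg u i m)" unfolding factors_iff by blast
qed

lemma inf_factors_factor: "v \<in> factors w \<Longrightarrow> w \<in> inf_factors u \<Longrightarrow> v \<in> inf_factors u"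
  using factors_seg[of v u] by (metis inf_factors_iff)

lemma palindrome_seg_suffix:
  assumes "palindrome (seg u k n')" "n \<le> n'"
  shows "seg u (k + n' - n) n = rev (seg u k n)"
  unfolding seg_eq_rev_iff
proof (intro allI impI)
  fix t assume t: "t < n"
  have "n - 1 - t < n'" using assms(2) t by linarith
  then have "u (k + (n - 1 - t)) = u (k + (n' - 1 - (n - 1 - t)))"
    by (rule assms(1)[unfolded palindrome_seg_iff, rule_format])
  also have "k + (n' - 1 - (n - 1 - t)) = k + n' - n + t" using assms(2) t by simp
  finally show "u (k + n' - n + t) = u (k + (n - 1 - t))" by simp
qed

text \<open>A complete return up to reversal: occurrences of the word and of its mirror image count
  alike. With palindromic returns the two then alternate, which is what the walks on extension
  graphs rely on.\<close>

definition consec :: "(nat \<Rightarrow> 'a) \<Rightarrow> nat \<Rightarrow> nat \<Rightarrow> nat \<Rightarrow> bool" where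
  "consec u i j n \<longleftrightarrow> i < j \<and> seg u j n \<in> {seg u i n, rev (seg u i n)} \<and>
     (\<forall>k. i < k \<and> k < j \<longrightarrow> seg u k n \<notin> {seg u i n, rev (seg u i n)})"

definition pal_returns :: "(nat \<Rightarrow> 'a) \<Rightarrow> nat \<Rightarrow> bool" where
  "pal_returns u n \<longleftrightarrow> (\<forall>i j. consec u i j n \<longrightarrow> palindrome (seg u i (j - i + n)))"

text \<open>Let \<open>q\<close> be the longest palindromic suffix of a window. If \<open>q\<close>
  had occurred earlier in it, the return from its last earlier occurrence would be a palindromic
  suffix longer than \<open>q\<close>. So \<open>q\<close> is new and \<open>defect_zeroI\<close>
  applies.\<close>

lemma defect_zero_if_pal_returns:
  assumes "\<And>n. pal_returns u n"
  shows "defect_inf u = 0"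
proof -
  have "defect w = 0" if "w \<in> inf_factors u" for w
  proof (rule defect_zeroI)
    obtain i where w: "w = seg u i (length w)" using \<open>w \<in> inf_factors u\<close> inf_factors_iff by blast
    fix p a s assume ps: "w = p @ [a] @ s"
    define l where "l = length p"
    have "length w = Suc l + length s" using ps by (simp add: l_def)
    then have "(p @ [a]) @ s = seg u i (Suc l) @ seg u (i + Suc l) (length s)"
      using w ps seg_append[of u i "Suc l"] by simp
    moreover have "length (p @ [a]) = length (seg u i (Suc l))" by (simp add: l_def)
    ultimately have pa: "p @ [a] = seg u i (Suc l)" by (metis append_eq_append_conv)
    then have p: "p = seg u i l" by (simp add: seg_snoc)
    \<comment> \<open>Lengths of palindromic suffixes of the window. The bound on \<open>n\<close>
      keeps the start of the suffix at or after \<open>i\<close>.\<close>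
    define S where "S = {n. n \<le> Suc l \<and> palindrome (seg u (i + Suc l - n) n)}"
    have finS: "finite S" by (rule finite_subset[of _ "{..Suc l}"]) (auto simp: S_def)
    have "0 \<in> S" by (simp add: S_def palindrome_def)
    define n where "n = Max S"
    have nS: "n \<in> S" using finS \<open>0 \<in> S\<close> unfolding n_def by (intro Max_in) auto
    define j where "j = i + Suc l - n"
    have jn: "j + n = i + Suc l" using nS by (simp add: j_def S_def)
    define q where "q = seg u j n"
    have q: "palindrome q" using nS by (simp add: S_def q_def j_def)
    have "q \<notin> factors p"
    proof
      assume "q \<in> factors p"
      then obtain k where k: "k \<ge> i" "k + n \<le> i + l" "q = seg u k n"
        using factors_seg[of q u i l] by (auto simp: p q_def)
      define K where "K = {k. k < j \<and> seg u k n = q}"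
      have finK: "finite K" by (rule finite_subset[of _ "{..<j}"]) (auto simp: K_def)
      have kK: "k \<in> K" using k jn by (simp add: K_def)
      define k' where "k' = Max K"
      have k'K: "k' \<in> K" using finK kK unfolding k'_def by (intro Max_in) auto
      have k'i: "k' \<ge> i" using Max_ge[OF finK kK] k(1) by (simp add: k'_def)
      have sk': "seg u k' n = q" and k'j: "k' < j" using k'K by (auto simp: K_def)
      have rq: "rev q = q" using q by (simp add: palindrome_def)
      have "consec u k' j n" unfolding consec_def sk' rq
      proof (intro conjI allI impI)
        show "k' < j" by (fact k'j)
        show "seg u j n \<in> {q, q}" by (simp add: q_def)
        fix m assume m: "k' < m \<and> m < j"
        then have "m \<notin> K" using Max_ge[OF finK, of m] by (auto simp: k'_def)
        then show "seg u m n \<notin> {q, q}" using m by (simp add: K_def)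
      qed
      then have "palindrome (seg u k' (j - k' + n))" using assms by (auto simp: pal_returns_def)
      moreover have "k' = i + Suc l - (j - k' + n)" "j - k' + n \<le> Suc l"
        using jn k'j k'i by auto
      ultimately have "j - k' + n \<in> S" by (simp add: S_def)
      then show False using Max_ge[OF finS, of "j - k' + n"] k'j by (simp add: n_def)
    qed
    moreover have "p @ [a] = seg u i (j - i) @ q"
    proof -
      have "Suc l = (j - i) + n" "i + (j - i) = j" using jn nS by (auto simp: S_def)
      then show ?thesis using pa seg_append[of u i "j - i" n] by (simp add: q_def)
    qed
    ultimately show "\<exists>r q. palindrome q \<and> p @ [a] = r @ q \<and> q \<notin> factors p"
      using q by blast
  qed
  then have "defect_inf u \<le> 0"
    unfolding defect_inf_def by (intro SUP_least) (simp add: zero_enat_def)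
  then show ?thesis by simp
qed

section \<open>Uniform recurrence and the effect of finite defect\<close>

definition unif_recurrent :: "(nat \<Rightarrow> 'a) \<Rightarrow> bool" where
  "unif_recurrent u \<longleftrightarrow> (\<forall>v \<in> inf_factors u. \<exists>B. \<forall>i. v \<in> factors (seg u i B))"

lemma unif_recurrent_long:
  assumes "unif_recurrent u" "v \<in> inf_factors u"
  shows "\<exists>B. \<forall>w \<in> inf_factors u. length w \<ge> B \<longrightarrow> v \<in> factors w"
proof -
  obtain B where B: "\<And>i. v \<in> factors (seg u i B)"
    using assms by (auto simp: unif_recurrent_def)
  have "v \<in> factors w" if "w \<in> inf_factors u" "length w \<ge> B" for w
  proof -
    obtain i where "w = seg u i (B + (length w - B))"
      using \<open>w \<in> inf_factors u\<close> \<open>length w \<ge> B\<close> inf_factors_iff[of w u] by auto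
    then have "seg u i B \<in> factors w" unfolding factors_iff seg_append by (metis append_Nil)
    then show ?thesis using B factors_trans by blast
  qed
  then show ?thesis by blast
qed

lemma recurrent_late:
  assumes "unif_recurrent u" "v \<in> inf_factors u"
  shows "\<exists>j\<ge>i. seg u j (length v) = v"
proof -
  obtain B where B: "\<And>i. v \<in> factors (seg u i B)"
    using assms by (auto simp: unif_recurrent_def)
  then show ?thesis using factors_seg[of v u i B] by metis
qed

lemma consec_exists:
  assumes "unif_recurrent u"
  shows "\<exists>j. consec u i j n"
proof -
  define P where "P j \<longleftrightarrow> i < j \<and> seg u j n \<in> {seg u i n, rev (seg u i n)}" for j
  have "\<exists>j\<ge>Suc i. seg u j n = seg u i n"
    using recurrent_late[OF assms, of "seg u i n" "Suc i"] by simp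
  then have ex: "\<exists>j. P j" unfolding P_def using Suc_le_lessD by blast
  have "P (LEAST j. P j)" by (rule LeastI_ex[OF ex])
  moreover have "\<not> P k" if "k < (LEAST j. P j)" for k using not_less_Least that by blast
  ultimately show ?thesis unfolding consec_def P_def by blast
qed

text \<open>A factor of maximal defect lies in every long window by uniform recurrence. Such a
  window already has maximal defect, so another letter cannot raise it and must create a new
  palindromic suffix.\<close>

lemma finite_defect_pal_suffix:
  assumes "unif_recurrent u" "defect_inf u < \<infinity>"
  shows "\<exists>N. \<forall>i m. m \<ge> N \<longrightarrow>
    (\<exists>p q. palindrome q \<and> seg u i (Suc m) = p @ q \<and> q \<notin> factors (seg u i m))"
proof -
  obtain d where d: "defect_inf u = enat d" using assms(2) by auto
  have bound: "defect w \<le> d" if "w \<in> inf_factors u" for w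
  proof -
    have "enat (defect w) \<le> defect_inf u" unfolding defect_inf_def using that by (rule SUP_upper)
    then show ?thesis using d by simp
  qed
  have "finite (defect ` inf_factors u)"
    by (rule finite_subset[of _ "{..d}"]) (use bound in auto)
  moreover have "defect ` inf_factors u \<noteq> {}" by (auto simp: inf_factors_def)
  ultimately have "Max (defect ` inf_factors u) \<in> defect ` inf_factors u" by (rule Max_in)
  then obtain w where w: "w \<in> inf_factors u" "defect w = Max (defect ` inf_factors u)" by auto
  have wmax: "defect v \<le> defect w" if "v \<in> inf_factors u" for v
    using that w(2) \<open>finite (defect ` inf_factors u)\<close> by simp
  obtain B where B: "\<forall>v \<in> inf_factors u. length v \<ge> B \<longrightarrow> w \<in> factors v"
    using unif_recurrent_long[OF assms(1) w(1)] by blast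
  have "\<exists>p q. palindrome q \<and> seg u i (Suc m) = p @ q \<and> q \<notin> factors (seg u i m)"
    if "m \<ge> B" for i m
  proof -
    have "defect w \<le> defect (seg u i m)" using B that by (intro defect_factor_le) simp
    moreover have "defect (seg u i (Suc m)) \<le> defect w" by (intro wmax) simp
    moreover have "defect (seg u i m) \<le> defect (seg u i m @ [u (i + m)])"
      by (rule defect_snoc_le)
    ultimately have "defect (seg u i m @ [u (i + m)]) = defect (seg u i m)"
      by (simp add: seg_snoc)
    from defect_snoc_eq[OF this] show ?thesis by (simp add: seg_snoc)
  qed
  then show ?thesis by blast
qed

text \<open>The return ends in a palindrome \<open>q\<close> that occurs nowhere earlier in it. If
  \<open>q\<close> had length at most \<open>n\<close>, it would be a suffix of the second
  occurrence and hence, directly or mirrored, a factor of the first. So \<open>q\<close> is longer,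
  and reflecting the second occurrence in \<open>q\<close> puts an occurrence at the start of
  \<open>q\<close>. None lies strictly between \<open>i\<close> and \<open>j\<close>, so
  \<open>q\<close> starts at \<open>i\<close> and is the whole return.\<close>

lemma finite_defect_pal_returns:
  assumes "unif_recurrent u" "defect_inf u < \<infinity>"
  shows "\<exists>N. \<forall>n\<ge>N. pal_returns u n"
proof -
  obtain N where N: "\<And>i m. m \<ge> N \<Longrightarrow>
    (\<exists>p q. palindrome q \<and> seg u i (Suc m) = p @ q \<and> q \<notin> factors (seg u i m))"
    using finite_defect_pal_suffix[OF assms] by blast
  have "palindrome (seg u i (j - i + n))" if "n \<ge> N" and c: "consec u i j n" for i j n
  proof -
    have ij: "i < j" and jn: "seg u j n = seg u i n \<or> seg u j n = rev (seg u i n)"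
      and none: "\<And>k. i < k \<Longrightarrow> k < j \<Longrightarrow> seg u k n \<notin> {seg u i n, rev (seg u i n)}"
      using c by (auto simp: consec_def)
    \<comment> \<open>\<open>seg u i (Suc m)\<close> is the return itself. Since
      \<open>i < j\<close>, the first occurrence still fits into the window shortened by one
      letter.\<close>
    define m where "m = j - i + n - 1"
    have m: "Suc m = j - i + n" "n \<le> m" using ij by (auto simp: m_def)
    obtain p q where q: "palindrome q" "seg u i (Suc m) = p @ q" "q \<notin> factors (seg u i m)"
      using N[of m i] m \<open>n \<ge> N\<close> by auto
    define n' where "n' = length q"
    have n': "length p + n' = Suc m" using arg_cong[OF q(2), of length] by (simp add: n'_def)
    have "seg u i (length p) @ seg u (i + length p) n' = p @ q"
      using q(2) seg_append[of u i "length p" n'] n' by simp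
    then have qs: "q = seg u (i + length p) n'" by (simp add: n'_def)
    show ?thesis
    proof (cases "n' \<le> n")
      case True
      have eq: "i + length p = j + n - n'" using n' m ij True by linarith
      have "q = seg u i n' \<or> q = seg u (i + n - n') n'"
        using jn
      proof
        assume s: "seg u j n = rev (seg u i n)"
        have "q = rev q" using q(1) by (simp add: palindrome_def)
        also have "rev q = seg u i n'"
        proof -
          have "seg u i n' = rev q"
            unfolding qs seg_eq_rev_iff
          proof (intro allI impI)
            fix t assume t: "t < n'"
            have "u (j + (n - 1 - t)) = u (i + (n - 1 - (n - 1 - t)))"
              by (rule s[unfolded seg_eq_rev_iff, rule_format]) (use t True in linarith)
            moreover have "n - 1 - (n - 1 - t) = t" "j + (n - 1 - t) = i + length p + (n' - 1 - t)"
              using t True eq by auto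
            ultimately show "u (i + t) = u (i + length p + (n' - 1 - t))" by simp
          qed
          then show ?thesis by simp
        qed
        finally show ?thesis by simp
      next
        assume s: "seg u j n = seg u i n"
        have "q = seg u (i + n - n') n'"
          unfolding qs seg_eq_iff
        proof (intro allI impI)
          fix t assume t: "t < n'"
          have "u (j + (n - n' + t)) = u (i + (n - n' + t))"
            by (rule s[unfolded seg_eq_iff, rule_format]) (use t True in linarith)
          moreover have "j + (n - n' + t) = i + length p + t" "i + (n - n' + t) = i + n - n' + t"
            using True eq by auto
          ultimately show "u (i + length p + t) = u (i + n - n' + t)" by simp
        qed
        then show ?thesis by simp
      qed
      then have "q \<in> factors (seg u i m)"
      proof
        assume "q = seg u i n'"
        then show ?thesis unfolding factors_seg using True m by (intro exI[of _ i]) (auto simp: n'_def)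
      next
        assume "q = seg u (i + n - n') n'"
        then show ?thesis unfolding factors_seg using True m
          by (intro exI[of _ "i + n - n'"]) (auto simp: n'_def)
      qed
      then show ?thesis using q(3) by blast
    next
      case False
      have eq: "i + length p + n' - n = j" using n' m ij by linarith
      have "seg u j n = rev (seg u (i + length p) n)"
        using palindrome_seg_suffix[of u "i + length p" n' n] q(1) qs False eq by simp
      then have "seg u (i + length p) n \<in> {seg u i n, rev (seg u i n)}"
        using jn by (metis insertCI rev_rev_ident)
      moreover have "i + length p < j" using eq False by linarith
      ultimately have "length p = 0" using none[of "i + length p"] by auto
      then have "seg u i (Suc m) = q" using q(2) by simp
      then show ?thesis using q(1) m by simp
    qed
  qed
  then show ?thesis unfolding pal_returns_def by blast
qed

text \<open>A palindromic return to a word long enough to contain \<open>v\<close> also contains the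
  reversal of \<open>v\<close>.\<close>

lemma inf_factors_rev:
  assumes "unif_recurrent u" "\<And>n. n \<ge> N \<Longrightarrow> pal_returns u n" "v \<in> inf_factors u"
  shows "rev v \<in> inf_factors u"
proof -
  obtain B where B: "\<forall>w \<in> inf_factors u. length w \<ge> B \<longrightarrow> v \<in> factors w"
    using unif_recurrent_long[OF assms(1,3)] by blast
  obtain j where "consec u 0 j (max N B)" using consec_exists[OF assms(1)] by blast
  then have pal: "palindrome (seg u 0 (j - 0 + max N B))"
    using assms(2)[of "max N B"] unfolding pal_returns_def by fastforce
  define w where "w = seg u 0 (j - 0 + max N B)"
  have "v \<in> factors w" using B by (simp add: w_def)
  then have "rev v \<in> factors w"
    using factors_rev[of "rev v" w] pal by (simp add: w_def palindrome_def)
  then show ?thesis using inf_factors_factor[of "rev v" w u] by (simp add: w_def)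
qed

section \<open>Walks on extension graphs\<close>

text \<open>What remains of the tree property when only a walk is given: between successive visits
  to a vertex, the first and the last neighbour agree. A loop, \<open>t = Suc s\<close>, satisfies
  this trivially.\<close>

definition first_return_rev :: "(nat \<Rightarrow> 'v) \<Rightarrow> bool" where
  "first_return_rev Z \<longleftrightarrow> (\<forall>s t. s < t \<and> Z s = Z t \<and> (\<forall>r. s < r \<and> r < t \<longrightarrow> Z r \<noteq> Z s)
     \<longrightarrow> Z (Suc s) = Z (t - 1))"

lemma first_return_revD:
  assumes "first_return_rev Z" "s < t" "Z s = Z t" "\<And>r. s < r \<Longrightarrow> r < t \<Longrightarrow> Z r \<noteq> Z s"
  shows "Z (Suc s) = Z (t - 1)"
  using assms unfolding first_return_rev_def by blast

text \<open>On an excursion from a vertex back to itself, \<open>V\<close> is first entered and last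
  left through the same neighbour. Induction on the duration: if the base vertex is not revisited,
  its two outer neighbours agree and the excursion can be trimmed at both ends. Otherwise it is cut
  at a revisit \<open>r\<close>. If \<open>V\<close> is met on both sides of \<open>r\<close>, the
  two halves are joined by the first-return property of \<open>V\<close> between its last visit
  before \<open>r\<close> and its first visit after \<open>r\<close>.\<close>

lemma excursions_same_edge:
  assumes R: "first_return_rev Z"
  shows "\<lbrakk>s < a; a \<le> b; b < t; Z s = Z t; Z a = V; Z b = V; Z s \<noteq> V;
    \<And>r. s < r \<Longrightarrow> r < a \<Longrightarrow> Z r \<noteq> V; \<And>r. b < r \<Longrightarrow> r < t \<Longrightarrow> Z r \<noteq> V\<rbrakk>
    \<Longrightarrow> Z (a - 1) = Z (Suc b)"
proof (induction "t - s" arbitrary: s t a b rule: less_induct)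
  case less
  note p = less.prems
  show ?case
  proof (cases "\<exists>r. s < r \<and> r < t \<and> Z r = Z s")
    case False
    then have Y: "Z (Suc s) = Z (t - 1)" using first_return_revD[OF R, of s t] p by auto
    show ?thesis
    proof (cases "a = Suc s")
      case True
      then have "Z (t - 1) = V" using Y p by simp
      then have "b = t - 1" using p(9)[of "t - 1"] p(3) by fastforce
      then show ?thesis using True p by simp
    next
      case a: False
      then have nV: "Z (Suc s) \<noteq> V" using p(8)[of "Suc s"] p(1) by simp
      then have "b \<noteq> t - 1" using Y p(6) by auto
      then have "b < t - 1" using p(3) by linarith
      moreover have "Suc s < a" using a p(1) by simp
      ultimately show ?thesis
        using less.hyps[of "t - 1" "Suc s" a b] p Y nV by auto
    qed
  next
    case True
    then obtain r where r: "s < r" "r < t" "Z r = Z s" by blast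
    consider "r < a" | "b < r" | "a < r" "r < b"
      using r(3) p(5,6,7) by (metis linorder_neqE_nat)
    then show ?thesis
    proof cases
      case 1
      then show ?thesis using less.hyps[of t r a b] p r by auto
    next
      case 2
      then show ?thesis using less.hyps[of r s a b] p r by auto
    next
      case 3
      define A where "A = {x. x < r \<and> Z x = V}"
      have finA: "finite A" by (rule finite_subset[of _ "{..<r}"]) (auto simp: A_def)
      have aA: "a \<in> A" using 3 p by (simp add: A_def)
      define a' where "a' = Max A"
      have a'A: "a' \<in> A" using finA aA unfolding a'_def by (intro Max_in) auto
      have aa': "a \<le> a'" using Max_ge[OF finA aA] by (simp add: a'_def)
      have a'max: "Z x \<noteq> V" if "a' < x" "x < r" for x
      proof -
        have "x \<notin> A" using Max_ge[OF finA, of x] that by (auto simp: a'_def)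
        then show ?thesis using that by (simp add: A_def)
      qed
      define b' where "b' = (LEAST x. r < x \<and> Z x = V)"
      have b'P: "r < b' \<and> Z b' = V" unfolding b'_def by (rule LeastI[of _ b]) (use 3 p in auto)
      have b'b: "b' \<le> b" unfolding b'_def by (rule Least_le) (use 3 p in auto)
      have b'min: "Z x \<noteq> V" if "r < x" "x < b'" for x
        using not_less_Least[of x "\<lambda>x. r < x \<and> Z x = V"] that by (auto simp: b'_def)
      have a'r: "a' < r" "Z a' = V" using a'A by (auto simp: A_def)
      have "Z (a - 1) = Z (Suc a')"
        using less.hyps[of r s a a'] p r aa' a'r a'max by auto
      also have "\<dots> = Z (b' - 1)"
      proof (rule first_return_revD[OF R])
        show "a' < b'" "Z a' = Z b'" using a'r b'P by auto
        fix x assume "a' < x" "x < b'"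
        then show "Z x \<noteq> Z a'"
          using a'max[of x] b'min[of x] a'r(2) r(3) p(7) by (metis linorder_neqE_nat)
      qed
      also have "\<dots> = Z (Suc b)"
        using less.hyps[of t r b' b] p r b'P b'b b'min by auto
      finally show ?thesis .
    qed
  qed
qed

text \<open>The edges of \<open>v\<close> are traversed by \<open>Z\<close> at unrelated times, so
  \<open>Z\<close> need not follow \<open>v\<close>. The invariant that links them is
  \<open>lab\<close>, the neighbour from which \<open>V\<close> is next entered. It depends only on
  the current vertex, is \<open>v 1\<close> after the first edge of \<open>v\<close>, is preserved
  by edges avoiding \<open>V\<close>, and equals \<open>v (k - 1)\<close> just before the last
  edge.\<close>

lemma closed_walk_same_edge:
  assumes R: "first_return_rev Z"
    and inf: "\<And>n. \<exists>t>n. Z t = V"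
    and v: "v 0 = V" "v k = V" "0 < k" "\<And>i. 0 < i \<Longrightarrow> i < k \<Longrightarrow> v i \<noteq> V"
    and edge: "\<And>i. i < k \<Longrightarrow> \<exists>t. Z t = v i \<and> Z (Suc t) = v (Suc i)"
  shows "v 1 = v (k - 1)"
proof (cases "k = 1")
  case True
  then show ?thesis using v by simp
next
  case False
  \<comment> \<open>The next visit to \<open>V\<close>, which exists since \<open>V\<close> is
    visited infinitely often.\<close>
  define nx where "nx t = (LEAST a. t < a \<and> Z a = V)" for t
  have nx: "t < nx t \<and> Z (nx t) = V" for t
    unfolding nx_def by (rule LeastI_ex) (use inf in blast)
  have nx_min: "Z r \<noteq> V" if "t < r" "r < nx t" for t r
    using not_less_Least[of r "\<lambda>a. t < a \<and> Z a = V"] that by (auto simp: nx_def)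
  have nx_eqI: "nx t = a" if "t < a" "Z a = V" "\<And>r. t < r \<Longrightarrow> r < a \<Longrightarrow> Z r \<noteq> V" for t a
    using nx[of t] nx_min[of t a] that by (metis linorder_neqE_nat)
  define lab where "lab t = Z (nx t - 1)" for t
  \<comment> \<open>If \<open>V\<close> is visited between \<open>s\<close> and \<open>t\<close>,
    the entry after \<open>s\<close> equals the exit before \<open>t\<close> by the excursion lemma,
    and that exit equals the entry after \<open>t\<close> by the first-return property of
    \<open>V\<close>. If not, both times share the same next visit.\<close>
  have lab_less: "lab s = lab t" if "s < t" "Z s = Z t" "Z s \<noteq> V" for s t
  proof (cases "nx s < t")
    case True
    define B where "B = {x. x < t \<and> Z x = V}"
    have finB: "finite B" by (rule finite_subset[of _ "{..<t}"]) (auto simp: B_def)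
    have aB: "nx s \<in> B" using True nx by (simp add: B_def)
    define b where "b = Max B"
    have bB: "b \<in> B" using finB aB unfolding b_def by (intro Max_in) auto
    have ab: "nx s \<le> b" using Max_ge[OF finB aB] by (simp add: b_def)
    have bmax: "Z x \<noteq> V" if "b < x" "x < t" for x
    proof -
      have "x \<notin> B" using Max_ge[OF finB, of x] that by (auto simp: b_def)
      then show ?thesis using that by (simp add: B_def)
    qed
    have b: "b < t" "Z b = V" using bB by (auto simp: B_def)
    have "lab s = Z (Suc b)"
      unfolding lab_def
      by (rule excursions_same_edge[OF R, of s "nx s" b t V])
        (use nx[of s] nx_min[of s] ab b bmax that in auto)
    also have "\<dots> = Z (nx t - 1)"
    proof (rule first_return_revD[OF R])
      show "b < nx t" using b nx[of t] by linarith
      show "Z b = Z (nx t)" using b nx[of t] by simp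
      fix r assume "b < r" "r < nx t"
      then show "Z r \<noteq> Z b"
        using bmax[of r] nx_min[of t r] b(2) that by (metis linorder_neqE_nat)
    qed
    finally show ?thesis by (simp add: lab_def)
  next
    case False
    then have "t < nx s" using nx[of s] that by (metis linorder_neqE_nat)
    then have "nx t = nx s" using nx[of s] nx_min[of s] \<open>s < t\<close> by (intro nx_eqI) auto
    then show ?thesis by (simp add: lab_def)
  qed
  have lab_eq: "lab s = lab t" if "Z s = Z t" "Z s \<noteq> V" for s t
    using lab_less[of s t] lab_less[of t s] that by (metis linorder_neqE_nat)
  have "lab t = v 1" if "Z t = v i" "1 \<le> i" "i < k" for t i
    using that(2,1,3)
  proof (induction i arbitrary: t rule: dec_induct)
    case base
    obtain t0 where t0: "Z t0 = V" "Z (Suc t0) = v 1" using edge[of 0] v by auto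
    have v1: "v 1 \<noteq> V" using v(4)[of 1] base by simp
    have "v 1 = Z (nx (Suc t0) - 1)"
      unfolding t0(2)[symmetric]
    proof (rule first_return_revD[OF R])
      show "t0 < nx (Suc t0)" "Z t0 = Z (nx (Suc t0))" using nx[of "Suc t0"] t0 by auto
      fix r assume "t0 < r" "r < nx (Suc t0)"
      then show "Z r \<noteq> Z t0"
        using t0 v1 nx_min[of "Suc t0" r] by (cases "r = Suc t0") auto
    qed
    then have "lab (Suc t0) = v 1" by (simp add: lab_def)
    then show ?case using lab_eq[of t "Suc t0"] base t0 v1 by simp
  next
    case (step i)
    obtain t0 where t0: "Z t0 = v i" "Z (Suc t0) = v (Suc i)" using edge[of i] step by auto
    have nV: "v (Suc i) \<noteq> V" using v(4)[of "Suc i"] step by simp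
    have "nx (Suc t0) = nx t0"
    proof (rule nx_eqI)
      show "Suc t0 < nx t0" using nx[of t0] t0 nV by (metis Suc_lessI)
      show "Z (nx t0) = V" using nx by blast
      show "Z r \<noteq> V" if "Suc t0 < r" "r < nx t0" for r using nx_min[of t0 r] that by simp
    qed
    then have "lab (Suc t0) = v 1" using step.IH[of t0] t0 step by (simp add: lab_def)
    then show ?case using lab_eq[of t "Suc t0"] step t0 nV by simp
  qed
  moreover obtain t where t: "Z t = v (k - 1)" "Z (Suc t) = V"
    using edge[of "k - 1"] v by auto
  moreover have "lab t = Z t" using nx_eqI[of t "Suc t"] t by (simp add: lab_def)
  ultimately show ?thesis using False v(3) by force
qed

section \<open>Cycles in the graph of two-sided extensions of a factor\<close>

definition flip :: "'a list \<Rightarrow> nat \<Rightarrow> 'a list" where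
  "flip c t = (if even t then c else rev c)"

lemma flip_0 [simp]: "flip c 0 = c"
  by (simp add: flip_def)

lemma flip_Suc [simp]: "flip c (Suc t) = rev (flip c t)"
  by (simp add: flip_def)

lemma length_flip [simp]: "length (flip c t) = length c"
  by (simp add: flip_def)

text \<open>The vertex visited at time \<open>t\<close> is \<open>(p t, flip c t)\<close>: an edge \<open>x c y\<close> leads from
  \<open>(x, c)\<close> to \<open>(y, rev c)\<close>, so the graph is bipartite (left and right extensions of \<open>c\<close>) unless \<open>c\<close> is
  a palindrome, in which case both sides are identified.\<close>

definition bad_walk :: "(nat \<Rightarrow> 'a) \<Rightarrow> 'a list \<Rightarrow> nat \<Rightarrow> (nat \<Rightarrow> 'a) \<Rightarrow> bool" where
  "bad_walk u c k p \<longleftrightarrow> 0 < k \<and> (\<forall>t<k. p t # flip c t @ [p (Suc t)] \<in> inf_factors u) \<and>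
     p k = p 0 \<and> flip c k = c \<and> (\<forall>t. 0 < t \<and> t < k \<longrightarrow> (p t, flip c t) \<noteq> (p 0, c)) \<and>
     p 1 \<noteq> p (k - 1)"

text \<open>Position 0 is excluded so that every occurrence has a letter to its left.\<close>

definition occs :: "(nat \<Rightarrow> 'a) \<Rightarrow> 'a list \<Rightarrow> nat set" where
  "occs u c = {q. 1 \<le> q \<and> seg u q (length c) \<in> {c, rev c}}"

lemma infinite_occs:
  assumes "unif_recurrent u" "c \<in> inf_factors u"
  shows "infinite (occs u c)"
proof -
  have "\<exists>j>m. j \<in> occs u c" for m
  proof -
    obtain j where "j \<ge> Suc m" "seg u j (length c) = c"
      using recurrent_late[OF assms, of "Suc m"] by blast
    then show ?thesis by (intro exI[of _ j]) (auto simp: occs_def)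
  qed
  then show ?thesis unfolding infinite_nat_iff_unbounded by blast
qed

text \<open>This makes the occurrences a walk: the letter that leaves one occurrence on the right is
  the letter that enters the next one on the left.\<close>

lemma consec_palindrome:
  assumes "i < j" "palindrome (seg u i (j - i + m))"
  shows "seg u j m = rev (seg u i m)" "u (j - 1) = u (i + m)"
proof -
  show "seg u j m = rev (seg u i m)"
    using palindrome_seg_suffix[OF assms(2), of m] assms(1) by simp
  have "u (i + m) = u (i + (j - i + m - 1 - m))"
    using assms(1) by (intro assms(2)[unfolded palindrome_seg_iff, rule_format]) simp
  also have "i + (j - i + m - 1 - m) = j - 1" using assms(1) by simp
  finally show "u (j - 1) = u (i + m)" by simp
qed

lemma occs_consec:
  assumes inf: "infinite (occs u c)" and q: "q = enumerate (occs u c)"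
  shows "consec u (q n) (q (Suc n)) (length c)"
proof -
  have Q: "seg u (q k) (length c) \<in> {c, rev c}" for k
    using enumerate_in_set[OF inf, of k] unfolding q occs_def by blast
  then have eq: "{seg u (q n) (length c), rev (seg u (q n) (length c))} = {c, rev c}"
    by (metis empty_iff insert_commute insert_iff rev_rev_ident)
  have mono: "q i < q j \<longleftrightarrow> i < j" for i j unfolding q by (rule enumerate_mono_iff[OF inf])
  have none: "seg u k (length c) \<notin> {c, rev c}" if k: "q n < k" "k < q (Suc n)" for k
  proof
    assume "seg u k (length c) \<in> {c, rev c}"
    then have "k \<in> occs u c" using k(1) unfolding occs_def by (intro CollectI conjI) auto
    then obtain r where "q r = k" using enumerate_Ex[OF inf, of k] q by blast
    then show False using k mono by auto
  qed
  show ?thesis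
    unfolding consec_def eq using mono[of n "Suc n"] Q[of "Suc n"] none by blast
qed

text \<open>The consecutive occurrences of \<open>c\<close> and of its reversal trace a walk on the words \<open>x # c\<close>
  and \<open>x # rev c\<close>; palindromic returns at length \<open>length c + 1\<close> say that this walk always comes
  back to a vertex through the edge by which it left, which rules out cycles.\<close>

lemma no_bad_walk:
  assumes ur: "unif_recurrent u" and M: "pal_returns u (length c)" "pal_returns u (Suc (length c))"
  shows "\<not> bad_walk u c k p"
proof
  assume bad: "bad_walk u c k p"
  define m where "m = length c"
  have k: "0 < k" and edge: "\<And>t. t < k \<Longrightarrow> p t # flip c t @ [p (Suc t)] \<in> inf_factors u"
    and close: "p k = p 0" "flip c k = c"
    and noret: "\<And>t. 0 < t \<Longrightarrow> t < k \<Longrightarrow> (p t, flip c t) \<noteq> (p 0, c)"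
    and ne: "p 1 \<noteq> p (k - 1)"
    using bad by (auto simp: bad_walk_def)
  have e0: "p 0 # c @ [p 1] \<in> inf_factors u" using edge[of 0] k by simp
  have "c \<in> inf_factors u"
    by (rule inf_factors_factor[OF _ e0]) (auto simp: factors_iff intro: exI[of _ "[p 0]"])
  then have inf: "infinite (occs u c)" by (rule infinite_occs[OF ur])
  define q where "q = enumerate (occs u c)"
  have Q: "q n \<in> occs u c" for n unfolding q_def by (rule enumerate_in_set[OF inf])
  have Q1: "1 \<le> q n" for n using Q[of n] by (simp add: occs_def)
  have Qs: "seg u (q n) m \<in> {c, rev c}" for n using Q[of n] by (simp add: occs_def m_def)
  have mono: "q i < q j \<longleftrightarrow> i < j" for i j unfolding q_def by (rule enumerate_mono_iff[OF inf])
  have mono_le: "q i \<le> q j \<longleftrightarrow> i \<le> j" for i j using mono[of j i] by linarith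
  have ex: "\<exists>n. q n = x" if "x \<in> occs u c" for x
    using enumerate_Ex[OF inf that] by (simp add: q_def)
  have step: "seg u (q (Suc n)) m = rev (seg u (q n) m)" "u (q (Suc n) - 1) = u (q n + m)" for n
  proof -
    have "consec u (q n) (q (Suc n)) m" unfolding m_def by (rule occs_consec[OF inf q_def])
    then have *: "q n < q (Suc n)" "palindrome (seg u (q n) (q (Suc n) - q n + m))"
      using M(1) by (auto simp: consec_def pal_returns_def m_def)
    show "seg u (q (Suc n)) m = rev (seg u (q n) m)" "u (q (Suc n) - 1) = u (q n + m)"
      by (rule consec_palindrome[OF *])+
  qed
  define Z where "Z n = (u (q n - 1), seg u (q n) m)" for n
  have Z_Suc: "Z (Suc n) = (u (q n + m), rev (seg u (q n) m))" for n
    unfolding Z_def step ..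
  have pre: "seg u (q n - 1) (Suc m) = fst (Z n) # snd (Z n)" for n
    using Q1[of n] by (simp add: Z_def seg_Suc)
  have post: "seg u (q n) (Suc m) = rev (fst (Z (Suc n)) # snd (Z (Suc n)))" for n
    by (simp add: Z_Suc seg_snoc)
  have R: "first_return_rev Z"
    unfolding first_return_rev_def
  proof (intro allI impI, elim conjE)
    fix s t
    assume st: "s < t" "Z s = Z t" and nr: "\<forall>r. s < r \<and> r < t \<longrightarrow> Z r \<noteq> Z s"
    show "Z (Suc s) = Z (t - 1)"
    proof (cases "t = Suc s")
      case True
      then show ?thesis using st by simp
    next
      case False
      \<comment> \<open>The vertex at time \<open>t\<close> can be read, mirrored, at the previous
        occurrence \<open>q t'\<close> together with the letter to its right. So \<open>X\<close> at
        \<open>q s - 1\<close> and its reversal at \<open>q t'\<close> are occurrences of words of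
        length \<open>m + 1\<close>. They are consecutive, since an occurrence of either word in
        between would be a visit to \<open>Z s\<close> between \<open>s\<close> and
        \<open>t\<close>.\<close>
      define t' where "t' = t - 1"
      have t': "t = Suc t'" "s < t'" using st(1) False by (auto simp: t'_def)
      define X where "X = fst (Z s) # snd (Z s)"
      have X: "seg u (q s - 1) (Suc m) = X" "seg u (q t') (Suc m) = rev X"
        using pre[of s] post[of t'] st(2) t' by (auto simp: X_def)
      have lt: "q s - 1 < q t'" using mono t' by (meson diff_le_self le_less_trans)
      have "consec u (q s - 1) (q t') (Suc m)"
        unfolding consec_def X
      proof (intro conjI allI impI)
        show "q s - 1 < q t'" by (fact lt)
        show "rev X \<in> {X, rev X}" by simp
        fix l assume l: "q s - 1 < l \<and> l < q t'"
        show "seg u l (Suc m) \<notin> {X, rev X}"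
        proof
          assume "seg u l (Suc m) \<in> {X, rev X}"
          then consider "seg u l (Suc m) = X" | "seg u l (Suc m) = rev X" by blast
          then show False
          proof cases
            case 1
            then have *: "u l = fst (Z s)" "seg u (Suc l) m = snd (Z s)"
              by (auto simp: seg_Suc X_def)
            then have "Suc l \<in> occs u c" using Qs[of s] by (simp add: occs_def Z_def m_def)
            then obtain r where r: "q r = Suc l" using ex by blast
            have "Z r = Z s" using * r by (simp add: Z_def)
            moreover have "q s < q r" "q r \<le> q t'" using l r Q1[of s] by auto
            then have "s < r" "r < t" using mono mono_le t' by auto
            ultimately show False using nr by blast
          next
            case 2
            then have *: "u (l + m) = fst (Z s)" "seg u l m = rev (snd (Z s))"
              by (auto simp: seg_snoc X_def)
            have "1 \<le> l" using l by linarith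
            then have "l \<in> occs u c"
              using * Qs[of s] by (auto simp: occs_def Z_def m_def)
            then obtain r where r: "q r = l" using ex by blast
            have "Z (Suc r) = Z s" using * r by (simp add: Z_Suc)
            moreover have "q s \<le> q r" "q r < q t'" using l r by auto
            then have "s < Suc r" "Suc r < t" using mono mono_le t' by auto
            ultimately show False using nr by blast
          qed
        qed
      qed
      then have "palindrome (seg u (q s - 1) (q t' - (q s - 1) + Suc m))"
        using M(2) by (auto simp: pal_returns_def m_def)
      from consec_palindrome(2)[OF lt this] have "u (q t' - 1) = u (q s + m)"
        using Q1[of s] by simp
      moreover have "rev (snd (Z t)) = seg u (q t') m" using t' by (simp add: Z_Suc)
      ultimately have "Z (Suc s) = Z t'" using st(2) unfolding Z_Suc by (simp add: Z_def)
      then show ?thesis by (simp add: t'_def)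
    qed
  qed
  define v where "v i = (p i, flip c i)" for i
  have "v 1 = v (k - 1)"
  proof (rule closed_walk_same_edge[OF R, of "(p 0, c)"])
    fix n
    have "p 0 # c \<in> inf_factors u"
      by (rule inf_factors_factor[OF _ e0]) (auto simp: factors_iff intro: exI[of _ "[]"])
    then obtain j where j: "j \<ge> q n" "seg u j (length (p 0 # c)) = p 0 # c"
      using recurrent_late[OF ur] by blast
    then have *: "u j = p 0" "seg u (Suc j) m = c" by (auto simp: seg_Suc m_def)
    then have "Suc j \<in> occs u c" by (simp add: occs_def m_def)
    then obtain t where t: "q t = Suc j" using ex by blast
    then have "n < t" "Z t = (p 0, c)" using mono[of n t] j(1) * by (auto simp: Z_def)
    then show "\<exists>t>n. Z t = (p 0, c)" by blast
  next
    \<comment> \<open>Each edge of \<open>p\<close> is a factor, so it occurs somewhere in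
      \<open>u\<close>, and by recurrence at an arbitrary enough place that its central word is one
      of the enumerated occurrences.\<close>
    fix i assume i: "i < k"
    let ?w = "p i # flip c i @ [p (Suc i)]"
    obtain j where j: "seg u j (length ?w) = ?w"
      using edge[OF i] inf_factors_iff by metis
    have "length ?w = Suc (Suc m)" by (simp add: m_def)
    then have "u j # seg u (Suc j) m @ [u (Suc j + m)] = ?w" using j seg_Suc_Suc by metis
    then have *: "u j = p i" "seg u (Suc j) m = flip c i" "u (Suc j + m) = p (Suc i)"
      by auto
    then have "Suc j \<in> occs u c" by (auto simp: occs_def m_def flip_def)
    then obtain t where t: "q t = Suc j" using ex by blast
    have "Z t = v i" "Z (Suc t) = v (Suc i)" using * t by (auto simp: Z_def[of t] Z_Suc v_def)
    then show "\<exists>t. Z t = v i \<and> Z (Suc t) = v (Suc i)" by blast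
  qed (use k close noret in \<open>auto simp: v_def\<close>)
  then show False using ne by (simp add: v_def)
qed

text \<open>In a shortest non-palindromic return, compare letters from both ends inwards up to the
  first mismatch: this displays it as \<open>x c a ... b (rev c) x\<close>. Returns to
  \<open>c\<close> inside it are shorter, hence palindromic, so the occurrences of \<open>c\<close>
  and \<open>rev c\<close> trace a walk from \<open>(x, c)\<close> back to \<open>(x, c)\<close>
  that leaves towards \<open>a\<close> and comes back from \<open>b\<close>.\<close>

lemma bad_walk_exists:
  assumes ur: "unif_recurrent u" and not_pal: "\<not> pal_returns u n0"
  shows "\<exists>c k p. bad_walk u c k p \<and> (pal_returns u 1 \<longrightarrow> c \<noteq> [])"
proof -
  define P where "P l \<longleftrightarrow> (\<exists>i j n. consec u i j n \<and> \<not> palindrome (seg u i (j - i + n)) \<and> l = j - i + n)" for l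
  define l where "l = (LEAST l. P l)"
  have "\<exists>l. P l" using not_pal unfolding pal_returns_def P_def by blast
  then have "P l" unfolding l_def by (rule LeastI_ex)
  then obtain i j n where c: "consec u i j n" and np: "\<not> palindrome (seg u i l)" and l: "l = j - i + n"
    unfolding P_def by blast
  have min: "palindrome (seg u i' (j' - i' + n'))" if "consec u i' j' n'" "j' - i' + n' < l" for i' j' n'
    using not_less_Least[of "j' - i' + n'" P] that unfolding l_def P_def by blast
  have ij: "i < j" and jn: "seg u j n \<in> {seg u i n, rev (seg u i n)}"
    and none: "\<And>k. i < k \<Longrightarrow> k < j \<Longrightarrow> seg u k n \<notin> {seg u i n, rev (seg u i n)}"
    using c by (auto simp: consec_def)
  have n0: "n \<noteq> 0"
  proof
    assume "n = 0"
    then have "j = Suc i" using none[of "Suc i"] ij by (metis Suc_lessI insertI1 lessI seg_0)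
    then show False using np l \<open>n = 0\<close> by (simp add: palindrome_def seg_Suc)
  qed
  \<comment> \<open>If both ends were equal and not mirrored, drop their first letter to get
    \<open>c\<close>. The last return to \<open>c\<close> ending at \<open>Suc j\<close> is shorter,
    hence palindromic, and shows the mirrored word at \<open>q e'\<close>, strictly between
    \<open>i\<close> and \<open>j\<close>.\<close>
  have jrev: "seg u j n = rev (seg u i n)"
  proof (rule ccontr)
    assume nrev: "seg u j n \<noteq> rev (seg u i n)"
    then have same: "seg u j n = seg u i n" using jn by blast
    obtain m where m: "n = Suc m" using n0 by (cases n) auto
    define c where "c = seg u (Suc i) m"
    have lc: "length c = m" by (simp add: c_def)
    have sj: "u j = u i" "seg u (Suc j) m = c" using same by (auto simp: m seg_Suc c_def)
    have inf: "infinite (occs u c)" by (rule infinite_occs[OF ur]) (simp add: c_def)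
    define q where "q = enumerate (occs u c)"
    have mono: "q a < q b \<longleftrightarrow> a < b" for a b unfolding q_def by (rule enumerate_mono_iff[OF inf])
    have ex: "\<exists>n. q n = x" if "x \<in> occs u c" for x
      using enumerate_Ex[OF inf that] by (simp add: q_def)
    have "Suc i \<in> occs u c" "Suc j \<in> occs u c" using sj by (auto simp: occs_def lc c_def)
    then obtain s e where s: "q s = Suc i" and e: "q e = Suc j" using ex by metis
    then have "s < e" using mono[of s e] ij by simp
    then obtain e' where e': "e = Suc e'" "s \<le> e'" by (cases e) auto
    have "q s \<le> q e'" using mono[of e' s] e'(2) by linarith
    then have qi: "i < q e'" using s by simp
    have qj: "q e' < Suc j" using mono[of e' e] e e' by simp
    have con: "consec u (q e') (Suc j) m"
      using occs_consec[OF inf q_def, of e'] e e' lc by simp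
    have "palindrome (seg u (q e') (Suc j - q e' + m))"
      by (rule min[OF con]) (use qi qj l m in linarith)
    from consec_palindrome[OF qj this]
    have "c = rev (seg u (q e') m)" "u i = u (q e' + m)" using sj by auto
    then have "seg u (q e') n = rev (seg u i n)"
      unfolding m seg_snoc[of u "q e'"] seg_Suc[of u i] c_def[symmetric] by simp
    moreover have "q e' < j" using calculation nrev qj by (metis less_SucE)
    ultimately show False using none[OF qi] by blast
  qed
  define D where "D t \<longleftrightarrow> t < l \<and> u (i + t) \<noteq> u (i + (l - 1 - t))" for t
  define e where "e = (LEAST t. D t)"
  have "\<exists>t. D t" using np unfolding palindrome_seg_iff D_def by blast
  then have De: "D e" unfolding e_def by (rule LeastI_ex)
  have small: "u (i + t) = u (i + (l - 1 - t))" if "t < e" for t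
  proof -
    have "\<not> D t" using not_less_Least[of t D] that by (simp add: e_def)
    then show ?thesis using that De by (simp add: D_def)
  qed
  have en: "n \<le> e"
  proof (rule ccontr)
    assume "\<not> n \<le> e"
    then have "u (j + (n - 1 - e)) = u (i + (n - 1 - (n - 1 - e)))"
      by (intro jrev[unfolded seg_eq_rev_iff, rule_format]) linarith
    moreover have "j + (n - 1 - e) = i + (l - 1 - e)" "n - 1 - (n - 1 - e) = e"
      using \<open>\<not> n \<le> e\<close> ij l by auto
    ultimately have "u (i + (l - 1 - e)) = u (i + e)" by (simp only:)
    then show False using De unfolding D_def by metis
  qed
  \<comment> \<open>A mismatch at \<open>e\<close> is also one at the mirrored position
    \<open>l - 1 - e\<close>, so the first mismatch lies strictly in the left half.\<close>
  have el: "Suc (e + e) < l"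
  proof (rule ccontr)
    assume *: "\<not> Suc (e + e) < l"
    define t where "t = l - 1 - e"
    have "t \<le> e" "l - 1 - t = e" using * De by (auto simp: t_def D_def)
    then show False using small[of t] De by (cases "t = e") (auto simp: D_def t_def)
  qed
  obtain m where m: "e = Suc m" using en n0 by (cases e) auto
  \<comment> \<open>Start of the mirrored copy of the matched prefix of length \<open>e\<close>,
    which is one letter \<open>x\<close> followed by \<open>c\<close>; hence
    \<open>e = Suc m\<close>.\<close>
  define j' where "j' = i + l - e"
  have j': "i + e < j'" "j' \<le> j" "j' + e = i + l" "j' + e = j + n"
    using el en ij l by (auto simp: j'_def)
  have je: "seg u j' e = rev (seg u i e)"
    unfolding seg_eq_rev_iff
  proof (intro allI impI)
    fix t assume t: "t < e"
    have "u (i + (e - 1 - t)) = u (i + (l - 1 - (e - 1 - t)))" using t by (intro small) simp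
    also have "i + (l - 1 - (e - 1 - t)) = j' + t" using t j' by linarith
    finally show "u (j' + t) = u (i + (e - 1 - t))" by simp
  qed
  \<comment> \<open>An occurrence of the matched prefix or of its mirror image contains one of the
    original word or its mirror image, strictly between \<open>i\<close> and
    \<open>j\<close>.\<close>
  have nonee: "seg u k e \<notin> {seg u i e, rev (seg u i e)}" if k: "i < k" "k < j'" for k
  proof
    have e: "e = n + (e - n)" "e = (e - n) + n" using en by auto
    assume "seg u k e \<in> {seg u i e, rev (seg u i e)}"
    then show False
    proof (elim insertE emptyE)
      assume "seg u k e = seg u i e"
      then have "seg u k n = seg u i n"
        using seg_append[of u k n "e - n"] seg_append[of u i n "e - n"] e(1) by (metis append_eq_append_conv length_seg)
      then show False using none[of k] k j' by simp
    next
      assume *: "seg u k e = rev (seg u i e)"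
      have "seg u k (e - n) @ seg u (k + (e - n)) n
          = rev (seg u (i + n) (e - n)) @ rev (seg u i n)"
        using * seg_append[of u k "e - n" n] seg_append[of u i n "e - n"] en by simp
      then have "seg u (k + (e - n)) n = rev (seg u i n)"
        by (metis append_eq_append_conv length_rev length_seg)
      moreover have "i < k + (e - n)" "k + (e - n) < j" using k j' en by linarith+
      ultimately show False using none[of "k + (e - n)"] by blast
    qed
  qed
  define c where "c = seg u (Suc i) m"
  have lc: "length c = m" by (simp add: c_def)
  have se: "seg u i e = u i # c" by (simp add: m seg_Suc c_def)
  have j'c: "seg u j' m = rev c" "u (j' + m) = u i"
    using je unfolding se by (auto simp: m seg_snoc)
  have inf: "infinite (occs u c)" by (rule infinite_occs[OF ur]) (simp add: c_def)
  define q where "q = enumerate (occs u c)"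
  have mono: "q a < q b \<longleftrightarrow> a < b" for a b unfolding q_def by (rule enumerate_mono_iff[OF inf])
  have mono_le: "q a \<le> q b \<longleftrightarrow> a \<le> b" for a b using mono[of b a] by linarith
  have ex: "\<exists>n. q n = x" if "x \<in> occs u c" for x
    using enumerate_Ex[OF inf that] by (simp add: q_def)
  have "Suc i \<in> occs u c" "j' \<in> occs u c"
    using j' j'c by (auto simp: occs_def lc c_def)
  then obtain s e2 where s: "q s = Suc i" and e2: "q e2 = j'" using ex by metis
  have se2: "s \<le> e2" using mono_le[of s e2] s e2 j' by simp
  define d where "d = e2 - s"
  have d: "s + d = e2" using se2 by (simp add: d_def)
  \<comment> \<open>Defined through the letter right of the previous occurrence, so that
    \<open>p (Suc d)\<close> is read inside the return, after the occurrence at \<open>j'\<close>.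
    For \<open>t \<le> d\<close> it is also the letter left of the current occurrence.\<close>
  define p where "p t = (case t of 0 \<Rightarrow> u i | Suc t' \<Rightarrow> u (q (s + t') + m))" for t
  have bounds: "Suc i \<le> q (s + t)" "q (s + t) \<le> j'" if "t \<le> d" for t
    using mono_le[of s "s + t"] mono_le[of "s + t" e2] s e2 d that by auto
  have walk: "t \<le> d \<Longrightarrow> seg u (q (s + t)) m = flip c t \<and> u (q (s + t) - 1) = p t" for t
  proof (induction t)
    case 0
    then show ?case by (simp add: s c_def p_def)
  next
    case (Suc t)
    have con: "consec u (q (s + t)) (q (Suc (s + t))) m"
      using occs_consec[OF inf q_def] lc by simp
    have lt: "q (s + t) < q (Suc (s + t))" using mono by simp
    have "palindrome (seg u (q (s + t)) (q (Suc (s + t)) - q (s + t) + m))"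
      by (rule min[OF con]) (use bounds[of t] bounds[of "Suc t"] Suc.prems lt j' m in \<open>simp; linarith\<close>)
    from consec_palindrome[OF lt this] show ?case using Suc by (simp add: p_def)
  qed
  have "bad_walk u c (Suc d) p"
    unfolding bad_walk_def
  proof (intro conjI allI impI)
    show "0 < Suc d" by simp
    fix t assume t: "t < Suc d"
    have "p t # flip c t @ [p (Suc t)] = seg u (q (s + t) - 1) (Suc (Suc m))"
    proof -
      have "Suc (q (s + t) - 1) = q (s + t)" using bounds[of t] t by simp
      then show ?thesis
        unfolding seg_Suc_Suc using walk[of t] t by (simp add: p_def)
    qed
    then show "p t # flip c t @ [p (Suc t)] \<in> inf_factors u" by simp
  next
    show "p (Suc d) = p 0" using d e2 j'c by (simp add: p_def)
    have "rev c = flip c d" using walk[of d] d e2 j'c by simp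
    then have "flip c (Suc d) = rev (rev c)" by simp
    then show "flip c (Suc d) = c" by simp
  next
    fix t assume t: "0 < t \<and> t < Suc d"
    show "(p t, flip c t) \<noteq> (p 0, c)"
    proof
      assume *: "(p t, flip c t) = (p 0, c)"
      have "q s < q (s + t)" using mono t by simp
      then have b: "i < q (s + t) - 1" "q (s + t) - 1 < j'" "Suc (q (s + t) - 1) = q (s + t)"
        using bounds[of t] s t by auto
      have "seg u (q (s + t) - 1) e = u i # c"
        using * walk[of t] t b(3) by (simp add: m seg_Suc p_def[of 0])
      then show False using nonee[OF b(1,2)] se by simp
    qed
  next
    have "p 1 = u (i + e)" using s by (simp add: p_def m)
    moreover have "p d = u (i + (l - 1 - e))"
    proof -
      have "j' - 1 = i + (l - 1 - e)" using el by (simp add: j'_def)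
      then show ?thesis using walk[of d] d e2 by simp
    qed
    ultimately show "p 1 \<noteq> p (Suc d - 1)" using De unfolding D_def diff_Suc_1 by metis
  qed
  \<comment> \<open>An empty \<open>c\<close> means \<open>e = 1\<close>, so \<open>n = 1\<close>
    and the chosen return is a return to a letter.\<close>
  moreover have "c \<noteq> []" if p1: "pal_returns u 1"
  proof
    assume "c = []"
    then have "e = 1" using lc m by simp
    then have "n = 1" using en n0 by simp
    then show False using p1 c np l unfolding pal_returns_def by blast
  qed
  ultimately show ?thesis by blast
qed

section \<open>Transport along a marked morphism\<close>

lemma morph_app_Nil [simp]: "morph_app f [] = []"
  by (simp add: morph_app_def)

lemma morph_app_Cons [simp]: "morph_app f (a # w) = f a @ morph_app f w"
  by (simp add: morph_app_def)

lemma morph_app_append [simp]: "morph_app f (v @ w) = morph_app f v @ morph_app f w"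
  by (simp add: morph_app_def)

lemma morph_app_conj:
  assumes "\<And>a. f a @ w = w @ g a"
  shows "morph_app f v @ w = w @ morph_app g v"
proof (induction v)
  case (Cons a v)
  then have "morph_app f (a # v) @ w = (f a @ w) @ morph_app g v" by simp
  then show ?case using assms by simp
qed simp

lemma rev_morph_app: "rev (morph_app f v) = morph_app (\<lambda>a. rev (f a)) (rev v)"
  by (induction v) auto

lemma length_morph_app_le:
  assumes "\<And>a. f a \<noteq> []"
  shows "length v \<le> length (morph_app f v)"
proof (induction v)
  case (Cons a v)
  then show ?case using assms[of a] by (cases "f a") auto
qed simp

lemma morph_app_eq_pointwise:
  assumes "\<And>a. length (f a) = length (g a)" "morph_app f v = morph_app g v" "a \<in> set v"
  shows "f a = g a"
  using assms(2,3) by (induction v) (auto simp: assms(1))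

text \<open>Distinct last letters allow decoding from the right.\<close>

lemma morph_app_inj:
  assumes "\<And>a. f a \<noteq> []" "inj (\<lambda>a. last (f a))"
  shows "morph_app f v = morph_app f v' \<Longrightarrow> v = v'"
proof (induction v arbitrary: v' rule: rev_induct)
  case Nil
  then show ?case using length_morph_app_le[of f v'] assms(1) by simp
next
  case (snoc a v)
  then have eq: "morph_app f v @ f a = morph_app f v'" by simp
  show ?case
  proof (cases v' rule: rev_cases)
    case Nil
    then show ?thesis using eq assms(1) by simp
  next
    case (snoc x b)
    then have eq': "morph_app f v @ f a = morph_app f x @ f b" using eq by simp
    have "last (f a) = last (morph_app f v @ f a)" using assms(1) by simp
    also have "\<dots> = last (f b)" unfolding eq' using assms(1) by simp
    finally have "a = b" using injD[OF assms(2)] by blast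
    then show ?thesis using snoc.IH[of x] eq' snoc by simp
  qed
qed

text \<open>\<open>R\<close> and \<open>L\<close> belong to a power of the morphism for which the
  boundary letters are fixed and not merely permuted. The premise of \<open>growing\<close> leaves
  out the one fixed case, the empty word with empty \<open>w\<close>.\<close>

locale marked_pair =
  fixes u :: "nat \<Rightarrow> 'a" and R L :: "'a morph" and w :: "'a list"
  assumes conj: "R a @ w = w @ L a"
    and nonerasing: "R a \<noteq> []"
    and last_R: "last (R a) = a"
    and hd_L: "hd (L a) = a"
    and closed: "v \<in> inf_factors u \<Longrightarrow> morph_app R v @ w \<in> inf_factors u"
    and growing: "v \<noteq> [] \<or> w \<noteq> [] \<Longrightarrow> \<exists>n. N \<le> length (((\<lambda>v. morph_app R v @ w) ^^ n) v)"
begin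

definition Phi :: "'a list \<Rightarrow> 'a list" where
  "Phi v = morph_app R v @ w"

lemma Phi_L: "Phi v = w @ morph_app L v"
  unfolding Phi_def by (rule morph_app_conj[OF conj])

lemma length_L: "length (L a) = length (R a)"
  using arg_cong[OF conj[of a], of length] by simp

text \<open>\<open>Phi (x v y)\<close> is \<open>R x\<close>, \<open>Phi v\<close>,
  \<open>L y\<close> in this order; \<open>R x\<close> ends in \<open>x\<close> and
  \<open>L y\<close> begins with \<open>y\<close>.\<close>

lemma Phi_extend:
  assumes "x # v @ [y] \<in> inf_factors u"
  shows "x # Phi v @ [y] \<in> inf_factors u"
proof -
  have "Phi (x # v @ [y]) = R x @ Phi v @ L y"
    using conj[of y] by (simp add: Phi_def)
  moreover have "R x = butlast (R x) @ [x]" using append_butlast_last_id[OF nonerasing, of x] last_R by simp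
  moreover have "L y = y # tl (L y)" using hd_L[of y] length_L[of y] nonerasing[of y] by (cases "L y") auto
  ultimately have "Phi (x # v @ [y]) = butlast (R x) @ (x # Phi v @ [y]) @ tl (L y)"
    by (metis append.assoc append_Cons append_Nil)
  then have "x # Phi v @ [y] \<in> factors (Phi (x # v @ [y]))" unfolding factors_iff by blast
  moreover have "Phi (x # v @ [y]) \<in> inf_factors u" unfolding Phi_def by (rule closed[OF assms])
  ultimately show ?thesis by (rule inf_factors_factor)
qed

lemma Phi_inj: "Phi v = Phi v' \<Longrightarrow> v = v'"
  using morph_app_inj[of R v v'] nonerasing by (simp add: Phi_def last_R)

lemma length_Phi: "length v \<le> length (Phi v)"
  using length_morph_app_le[of R v] nonerasing by (simp add: Phi_def)

text \<open>Reading \<open>Phi W\<close> forwards through \<open>L\<close> and backwards through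
  \<open>R\<close> gives two factorisations with blocks of equal lengths. They agree block by block,
  and every letter occurs in \<open>W\<close>.\<close>

lemma Phi_rev_if_palindromes:
  assumes "palindrome W" "palindrome (Phi W)" "set W = UNIV"
  shows "Phi (rev v) = rev (Phi v)"
proof -
  have "w @ morph_app L W = rev (Phi W)"
    using assms(2) Phi_L[of W] by (simp add: palindrome_def)
  also have "\<dots> = rev w @ morph_app (\<lambda>a. rev (R a)) W"
    using assms(1) by (simp add: Phi_def rev_morph_app palindrome_def)
  finally have eq: "w = rev w" "morph_app L W = morph_app (\<lambda>a. rev (R a)) W" by simp_all
  have "L a = rev (R a)" for a
    by (rule morph_app_eq_pointwise[OF _ eq(2)]) (use assms(3) length_L in auto)
  then have "L = (\<lambda>a. rev (R a))" by blast
  then show ?thesis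
    using Phi_L[of "rev v"] eq(1) by (simp add: Phi_def rev_morph_app)
qed

text \<open>At odd times the central word is reversed. Since \<open>Phi\<close> need not commute
  with reversal, the edge is reversed, mapped and reversed back.\<close>

lemma walk_Phi:
  assumes rc: "\<And>v. v \<in> inf_factors u \<Longrightarrow> rev v \<in> inf_factors u"
    and "\<And>t. t < k \<Longrightarrow> p t # flip c t @ [p (Suc t)] \<in> inf_factors u" "t < k"
  shows "p t # flip ((Phi ^^ n) c) t @ [p (Suc t)] \<in> inf_factors u"
proof (induction n)
  case 0
  then show ?case using assms by simp
next
  case (Suc n)
  show ?case
  proof (cases "even t")
    case True
    then show ?thesis using Phi_extend[OF Suc[unfolded flip_def]] by (auto simp: flip_def)
  next
    case False
    then have "p (Suc t) # (Phi ^^ n) c @ [p t] \<in> inf_factors u"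
      using rc[OF Suc] by (simp add: flip_def)
    from rc[OF Phi_extend[OF this]] show ?thesis using False by (simp add: flip_def)
  qed
qed

text \<open>If \<open>c\<close> is no palindrome but all its long images are, comparing the two factorisations of a
  long palindromic image forces \<open>R a = rev (L a)\<close>, and then \<open>c\<close> would be a palindrome too.
  If \<open>c\<close> is a palindrome with a non-palindromic image, an odd walk is traversed twice.\<close>

lemma bad_walk_Phi:
  assumes rc: "\<And>v. v \<in> inf_factors u \<Longrightarrow> rev v \<in> inf_factors u"
    and bad: "bad_walk u c k p" and ne: "c \<noteq> [] \<or> w \<noteq> []"
    and letters: "\<And>W. W \<in> inf_factors u \<Longrightarrow> B \<le> length W \<Longrightarrow> set W = UNIV"
  shows "\<exists>n k' p'. N \<le> length ((Phi ^^ n) c) \<and> bad_walk u ((Phi ^^ n) c) k' p'"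
proof -
  have k: "0 < k" and edge: "\<And>t. t < k \<Longrightarrow> p t # flip c t @ [p (Suc t)] \<in> inf_factors u"
    and close: "p k = p 0" "flip c k = c"
    and noret: "\<And>t. 0 < t \<Longrightarrow> t < k \<Longrightarrow> (p t, flip c t) \<noteq> (p 0, c)"
    and p1: "p 1 \<noteq> p (k - 1)"
    using bad by (auto simp: bad_walk_def)
  have grow: "\<exists>n. M \<le> length ((Phi ^^ n) c)" for M
    using growing[OF ne, of M] unfolding Phi_def[abs_def] .
  show ?thesis
  proof (cases "palindrome c")
    case True
    then have fc: "flip c t = c" for t by (simp add: flip_def palindrome_def)
    have nr: "p t \<noteq> p 0" if "0 < t" "t < k" for t using noret[OF that] fc by simp
    obtain n where n: "N \<le> length ((Phi ^^ n) c)" using grow by blast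
    define W where "W = (Phi ^^ n) c"
    show ?thesis
    proof (cases "flip W k = W")
      case True
      have "bad_walk u W k p"
        unfolding bad_walk_def
        using k close(1) True nr p1 walk_Phi[OF rc edge, where n=n] by (auto simp: W_def)
      then show ?thesis using n unfolding W_def by blast
    next
      case False
      then have odd: "odd k" and nW: "rev W \<noteq> W" by (auto simp: flip_def split: if_splits)
      have "k \<noteq> 1" using p1 close(1) by auto
      then have k2: "2 \<le> k" using k by simp
      \<comment> \<open>Two rounds of the odd walk. Halfway, at time \<open>k\<close>, the letter is
        that of the start but the central word is \<open>rev W\<close>, which differs from
        \<open>W\<close>.\<close>
      define p' where "p' t = (if t \<le> k then p t else p (t - k))" for t
      have e': "p' t # flip c t @ [p' (Suc t)] \<in> inf_factors u" if "t < 2 * k" for t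
      proof (cases "t < k")
        case True
        then show ?thesis using edge[of t] by (simp add: p'_def)
      next
        case False
        then have "p' t = p (t - k)" "p' (Suc t) = p (Suc (t - k))"
          using close(1) by (auto simp: p'_def Suc_diff_le)
        then show ?thesis using edge[of "t - k"] fc False that by simp
      qed
      have "bad_walk u W (2 * k) p'"
        unfolding bad_walk_def
      proof (intro conjI allI impI)
        fix t assume "t < 2 * k"
        then show "p' t # flip W t @ [p' (Suc t)] \<in> inf_factors u"
          using walk_Phi[OF rc e', of "2 * k" t n] by (simp add: W_def)
      next
        show "p' (2 * k) = p' 0" using k close(1) by (simp add: p'_def)
        show "p' 1 \<noteq> p' (2 * k - 1)" using k2 p1 by (auto simp: p'_def)
        fix t assume t: "0 < t \<and> t < 2 * k"
        show "(p' t, flip W t) \<noteq> (p' 0, W)"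
        proof
          assume *: "(p' t, flip W t) = (p' 0, W)"
          then have "even t" using nW by (auto simp: flip_def split: if_splits)
          then have "t \<noteq> k" using odd by blast
          moreover have "t - k < k" using t by linarith
          ultimately
          show False using * nr[of t] nr[of "t - k"] t by (auto simp: p'_def split: if_splits)
        qed
      qed (use k in \<open>auto simp: flip_def\<close>)
      then show ?thesis using n unfolding W_def by blast
    qed
  next
    case False
    then have ncp: "rev c \<noteq> c" by (simp add: palindrome_def)
    then have ek: "even k" using close(2) by (auto simp: flip_def split: if_splits)
    have "\<exists>n. N \<le> length ((Phi ^^ n) c) \<and> \<not> palindrome ((Phi ^^ n) c)"
    proof (rule ccontr)
      assume "\<not> ?thesis"
      then have pal: "palindrome ((Phi ^^ n) c)" if "N \<le> length ((Phi ^^ n) c)" for n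
        using that by blast
      obtain n where n: "max N B \<le> length ((Phi ^^ n) c)" using grow by blast
      have P1: "palindrome ((Phi ^^ n) c)" using n by (intro pal) simp
      have P2: "palindrome (Phi ((Phi ^^ n) c))"
        using pal[of "Suc n"] n length_Phi[of "(Phi ^^ n) c"] by simp
      have "p 0 # (Phi ^^ n) c @ [p 1] \<in> inf_factors u"
        using walk_Phi[OF rc edge, of k 0 n] k by simp
      then have "(Phi ^^ n) c \<in> inf_factors u"
        by (rule inf_factors_factor[rotated]) (auto simp: factors_iff intro: exI[of _ "[p 0]"])
      then have "set ((Phi ^^ n) c) = UNIV" using n by (intro letters) auto
      from Phi_rev_if_palindromes[OF P1 P2 this] have rv: "Phi (rev v) = rev (Phi v)" for v .
      \<comment> \<open>Injectivity of \<open>Phi\<close> carries palindromicity back from the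
        iterates to \<open>c\<close>.\<close>
      have "rev ((Phi ^^ j) c) = (Phi ^^ j) c \<Longrightarrow> rev c = c" for j
      proof (induction j)
        case (Suc j)
        then have "Phi (rev ((Phi ^^ j) c)) = Phi ((Phi ^^ j) c)" by (simp add: rv)
        then show ?case using Phi_inj Suc.IH by blast
      qed simp
      then show False using P1 ncp by (simp add: palindrome_def)
    qed
    then obtain n where n: "N \<le> length ((Phi ^^ n) c)" "rev ((Phi ^^ n) c) \<noteq> (Phi ^^ n) c"
      by (auto simp: palindrome_def)
    define W where "W = (Phi ^^ n) c"
    have "bad_walk u W k p"
      unfolding bad_walk_def
    proof (intro conjI allI impI)
      show "flip W k = W" using ek by (simp add: flip_def)
      fix t assume t: "t < k"
      then show "p t # flip W t @ [p (Suc t)] \<in> inf_factors u"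
        using walk_Phi[OF rc edge, of k t n] by (simp add: W_def)
    next
      fix t assume t: "0 < t \<and> t < k"
      show "(p t, flip W t) \<noteq> (p 0, W)"
      proof
        assume *: "(p t, flip W t) = (p 0, W)"
        then have "even t" using n(2) by (auto simp: flip_def W_def split: if_splits)
        then show False using * noret[of t] t by (simp add: flip_def)
      qed
    qed (use k close p1 in auto)
    then show ?thesis using n(1) unfolding W_def by blast
  qed
qed

end

section \<open>Fixed points of primitive marked morphisms\<close>

text \<open>Pigeonhole on the pairs of powers, then cancellation by injectivity.\<close>

lemma inj_common_power:
  fixes f g :: "'a::finite \<Rightarrow> 'a"
  assumes "inj f" "inj g"
  shows "\<exists>n>0. f ^^ n = id \<and> g ^^ n = id"
proof -
  have "\<not> inj (\<lambda>n::nat. (f ^^ n, g ^^ n))"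
    using finite_imageD[of "\<lambda>n::nat. (f ^^ n, g ^^ n)" UNIV] finite_subset[OF subset_UNIV]
      infinite_UNIV_nat by (metis finite)
  then obtain m n where mn: "m < n" "f ^^ m = f ^^ n" "g ^^ m = g ^^ n"
    unfolding inj_def by (metis linorder_neqE_nat prod.inject)
  have *: "h ^^ (n - m) = id" if "inj h" "h ^^ m = h ^^ n" for h :: "'a \<Rightarrow> 'a"
  proof
    fix x
    have "(h ^^ m) ((h ^^ (n - m)) x) = (h ^^ n) x"
      using mn(1) by (metis comp_apply funpow_add le_add_diff_inverse less_imp_le_nat)
    also have "\<dots> = (h ^^ m) x" using that(2) by simp
    finally show "(h ^^ (n - m)) x = id x"
      using inj_fn[OF that(1), of m] by (simp add: inj_eq)
  qed
  show ?thesis using *[OF assms(1) mn(2)] *[OF assms(2) mn(3)] mn(1)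
    by (intro exI[of _ "n - m"]) simp
qed

text \<open>The composites of \<open>R0\<close> with \<open>R\<close> and of \<open>L0\<close> with
  \<open>L\<close> are conjugated by \<open>morph_app R0 w @ w0\<close>. With this choice the map
  belonging to the power is exactly the iterate of the original map.\<close>

lemma conj_pair_power:
  fixes R0 L0 :: "'a morph"
  assumes conj: "\<And>a. R0 a @ w0 = w0 @ L0 a" and ne: "\<And>a. R0 a \<noteq> []"
  shows "\<exists>R L w. (\<forall>a. R a @ w = w @ L a) \<and> (\<forall>a. R a \<noteq> []) \<and>
    (\<forall>a. last (R a) = ((\<lambda>a. last (R0 a)) ^^ n) a) \<and> (\<forall>a. hd (L a) = ((\<lambda>a. hd (L0 a)) ^^ n) a) \<and>
    (\<forall>v. morph_app R v @ w = ((\<lambda>v. morph_app R0 v @ w0) ^^ n) v)"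
proof (induction n)
  case 0
  have "morph_app (\<lambda>a. [a]) v = v" for v :: "'a list" by (induction v) auto
  then show ?case by (intro exI[of _ "\<lambda>a. [a]"] exI[of _ "[]"]) simp
next
  case (Suc n)
  then obtain R L w where IH: "\<And>a. R a @ w = w @ L a" "\<And>a. R a \<noteq> []"
    "\<And>a. last (R a) = ((\<lambda>a. last (R0 a)) ^^ n) a" "\<And>a. hd (L a) = ((\<lambda>a. hd (L0 a)) ^^ n) a"
    "\<And>v. morph_app R v @ w = ((\<lambda>v. morph_app R0 v @ w0) ^^ n) v" by blast
  have neL0: "L0 a \<noteq> []" for a using arg_cong[OF conj[of a], of length] ne[of a] by auto
  have neL: "L a \<noteq> []" for a using arg_cong[OF IH(1)[of a], of length] IH(2)[of a] by auto
  have C: "morph_app R0 v @ w0 = w0 @ morph_app L0 v" for v by (rule morph_app_conj[OF conj])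
  show ?case
  proof (intro exI conjI allI)
    fix a
    have "morph_app R0 (R a) @ morph_app R0 w @ w0 = morph_app R0 (R a @ w) @ w0" by simp
    also have "\<dots> = morph_app R0 w @ morph_app R0 (L a) @ w0" unfolding IH(1) by simp
    also have "\<dots> = (morph_app R0 w @ w0) @ morph_app L0 (L a)" using C by simp
    finally show "morph_app R0 (R a) @ (morph_app R0 w @ w0)
        = (morph_app R0 w @ w0) @ morph_app L0 (L a)" .
    have "length (R a) \<le> length (morph_app R0 (R a))" by (rule length_morph_app_le[OF ne])
    then show "morph_app R0 (R a) \<noteq> []" using IH(2)[of a] by auto
    have "R a = butlast (R a) @ [last (R a)]" using IH(2) by simp
    then have "morph_app R0 (R a) = morph_app R0 (butlast (R a)) @ R0 (last (R a))"
      by (metis append_Nil2 morph_app_Cons morph_app_Nil morph_app_append)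
    then show "last (morph_app R0 (R a)) = ((\<lambda>a. last (R0 a)) ^^ Suc n) a"
      using ne IH(3) by simp
    have "L a = hd (L a) # tl (L a)" using neL by simp
    then have "morph_app L0 (L a) = L0 (hd (L a)) @ morph_app L0 (tl (L a))"
      by (metis morph_app_Cons)
    then show "hd (morph_app L0 (L a)) = ((\<lambda>a. hd (L0 a)) ^^ Suc n) a"
      using neL0 IH(4) by simp
  next
    fix v
    have "morph_app (\<lambda>a. morph_app R0 (R a)) v = morph_app R0 (morph_app R v)"
      by (induction v) auto
    then have "morph_app (\<lambda>a. morph_app R0 (R a)) v @ morph_app R0 w @ w0
        = morph_app R0 (morph_app R v @ w) @ w0" by simp
    then show "morph_app (\<lambda>a. morph_app R0 (R a)) v @ (morph_app R0 w @ w0)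
        = ((\<lambda>v. morph_app R0 v @ w0) ^^ Suc n) v"
      by (simp add: IH(5))
  qed
qed

lemma marked_pair_power:
  fixes u :: "nat \<Rightarrow> 'a::finite" and R0 L0 :: "'a morph"
  assumes conj: "\<And>a. R0 a @ w0 = w0 @ L0 a" and ne: "\<And>a. R0 a \<noteq> []"
    and inj: "inj (\<lambda>a. last (R0 a))" "inj (\<lambda>a. hd (L0 a))"
    and closed: "\<And>v. v \<in> inf_factors u \<Longrightarrow> morph_app R0 v @ w0 \<in> inf_factors u"
    and growing: "\<And>v N. v \<noteq> [] \<or> w0 \<noteq> [] \<Longrightarrow> \<exists>n. N \<le> length (((\<lambda>v. morph_app R0 v @ w0) ^^ n) v)"
  shows "\<exists>R L w. marked_pair u R L w \<and> (w0 \<noteq> [] \<longrightarrow> w \<noteq> [])"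
proof -
  obtain K where K: "K > 0" "(\<lambda>a. last (R0 a)) ^^ K = id" "(\<lambda>a. hd (L0 a)) ^^ K = id"
    using inj_common_power[OF inj] by blast
  define F where "F = (\<lambda>v. morph_app R0 v @ w0)"
  have "\<exists>R L w. (\<forall>a. R a @ w = w @ L a) \<and> (\<forall>a. R a \<noteq> []) \<and> (\<forall>a. last (R a) = a) \<and>
      (\<forall>a. hd (L a) = a) \<and> (\<forall>v. morph_app R v @ w = (F ^^ K) v)"
    using conj_pair_power[of R0 w0 L0 K, OF conj ne] unfolding K(2,3) id_apply F_def .
  then obtain R L w where RL: "\<And>a. R a @ w = w @ L a" "\<And>a. R a \<noteq> []"
    "\<And>a. last (R a) = a" "\<And>a. hd (L a) = a"
    and F: "\<And>v. morph_app R v @ w = (F ^^ K) v"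
    by blast
  have Fle: "length v + length w0 \<le> length (F v)" for v
    using length_morph_app_le[of R0 v, OF ne] by (simp add: F_def)
  have Fmono: "length v \<le> length ((F ^^ n) v)" for n v
  proof (induction n)
    case (Suc n)
    then show ?case using Fle[of "(F ^^ n) v"] by simp
  qed simp
  have F_closed: "(F ^^ n) v \<in> inf_factors u" if "v \<in> inf_factors u" for n v
    by (induction n) (use that closed in \<open>auto simp: F_def\<close>)
  have "w = (F ^^ K) []" using F[of "[]"] by simp
  moreover have "(F ^^ n) [] = []" if "w0 = []" for n by (induction n) (auto simp: F_def that)
  ultimately have w_Nil: "w0 = [] \<Longrightarrow> w = []" by simp
  have "w \<noteq> []" if "w0 \<noteq> []"
  proof -
    have "length (F []) \<le> length ((F ^^ (K - 1)) (F []))" by (rule Fmono)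
    also have "(F ^^ (K - 1)) (F []) = w"
      using \<open>w = (F ^^ K) []\<close> K(1) by (metis Suc_diff_1 comp_apply funpow_Suc_right)
    finally show ?thesis using Fle[of "[]"] that by auto
  qed
  moreover have "marked_pair u R L w"
  proof
    fix v assume "v \<in> inf_factors u"
    then show "morph_app R v @ w \<in> inf_factors u" unfolding F by (rule F_closed)
  next
    fix v :: "'a list" and N assume "v \<noteq> [] \<or> w \<noteq> []"
    then have "v \<noteq> [] \<or> w0 \<noteq> []" using w_Nil by blast
    then obtain n where n: "N \<le> length ((F ^^ n) v)" using growing unfolding F_def by blast
    \<comment> \<open>\<open>F\<close> never shortens a word, so \<open>K * n\<close> iterations
      give at least the length reached after \<open>n\<close>.\<close>
    have "(F ^^ (K * n - n + n)) v = (F ^^ (K * n - n)) ((F ^^ n) v)"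
      unfolding funpow_add by simp
    moreover have "K * n - n + n = K * n" using K(1) by simp
    ultimately have "N \<le> length ((F ^^ (K * n)) v)"
      using n Fmono[of "(F ^^ n) v" "K * n - n"] by simp
    moreover have "(\<lambda>v. morph_app R v @ w) = F ^^ K" by (rule ext) (rule F)
    ultimately show "\<exists>n. N \<le> length (((\<lambda>v. morph_app R v @ w) ^^ n) v)"
      by (intro exI[of _ n]) (simp add: funpow_mult mult.commute)
  qed (use RL in auto)
  ultimately show ?thesis by blast
qed

section \<open>Recurrence and closure properties of the fixed point\<close>

lemma pref_eq_seg: "pref u n = seg u 0 n"
  by (simp add: pref_def seg_def)

lemma fixed_point_seg:
  assumes "fixed_point \<phi> u"
  shows "\<exists>m. morph_app \<phi> (seg u 0 n) = seg u 0 m"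
proof -
  let ?w = "morph_app \<phi> (seg u 0 n)"
  have "?w = seg u 0 (length ?w)"
    using assms unfolding fixed_point_def pref_eq_seg by (intro nth_equalityI) auto
  then show ?thesis by blast
qed

lemma fixed_point_power_seg:
  assumes "fixed_point \<phi> u"
  shows "\<exists>m. (morph_app \<phi> ^^ k) (seg u 0 n) = seg u 0 m"
proof (induction k)
  case (Suc k)
  then show ?case using fixed_point_seg[OF assms] by (metis comp_apply funpow.simps(2))
qed auto

lemma morph_power_append:
  "(morph_app \<phi> ^^ k) (v @ w) = (morph_app \<phi> ^^ k) v @ (morph_app \<phi> ^^ k) w"
  by (induction k arbitrary: v w) auto

lemma morph_power_Nil: "(morph_app \<phi> ^^ k) [] = []"
  by (induction k) auto

lemma fixed_point_closed:
  assumes "fixed_point \<phi> u" "v \<in> inf_factors u"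
  shows "morph_app \<phi> v \<in> inf_factors u"
proof -
  obtain i where "v = seg u i (length v)" using assms(2) inf_factors_iff by blast
  then have "seg u 0 (i + length v) = seg u 0 i @ v" using seg_append[of u 0 i "length v"] by simp
  then obtain m where "morph_app \<phi> (seg u 0 i) @ morph_app \<phi> v = seg u 0 m"
    using fixed_point_seg[OF assms(1)] by (metis morph_app_append)
  then have "morph_app \<phi> v \<in> factors (seg u 0 m)" unfolding factors_iff by (metis append_Nil2)
  then show ?thesis by (rule inf_factors_factor) simp
qed

lemma primitive_nonerasing:
  assumes "primitive \<phi>"
  shows "\<phi> a \<noteq> []"
proof
  assume "\<phi> a = []"
  obtain k where k: "k > 0" "a \<in> set ((morph_app \<phi> ^^ k) [a])"
    using assms unfolding primitive_def by blast
  have "(morph_app \<phi> ^^ k) [a] = (morph_app \<phi> ^^ (k - 1)) (morph_app \<phi> [a])"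
    using k(1) by (metis Suc_diff_1 comp_apply funpow_Suc_right)
  then show False using k(2) \<open>\<phi> a = []\<close> by (simp add: morph_power_Nil)
qed

text \<open>The \<open>k\<close>-th power maps each letter to a word containing both
  \<open>a\<close> and \<open>b\<close>, so it at least doubles lengths.\<close>

lemma primitive_growing:
  fixes \<phi> :: "'a::finite morph"
  assumes k: "\<And>a b. b \<in> set ((morph_app \<phi> ^^ k) [a])" and ab: "(a::'a) \<noteq> b"
  shows "2 ^ n * length v \<le> length ((morph_app \<phi> ^^ (k * n)) v)"
proof -
  define g where "g = morph_app \<phi> ^^ k"
  have g1: "2 \<le> length (g [c])" for c
  proof -
    have "card {a, b} \<le> card (set (g [c]))" using k[of _ c] by (intro card_mono) (auto simp: g_def)
    then show ?thesis using ab card_length[of "g [c]"] by simp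
  qed
  have g: "2 * length v \<le> length (g v)" for v
  proof (induction v)
    case (Cons c v)
    have "g (c # v) = g [c] @ g v" using morph_power_append[of k \<phi> "[c]" v] by (simp add: g_def)
    then show ?case using g1[of c] Cons by simp
  qed simp
  have "2 ^ n * length v \<le> length ((g ^^ n) v)"
  proof (induction n)
    case (Suc n)
    then show ?case using g[of "(g ^^ n) v"] by simp
  qed simp
  then show ?thesis unfolding g_def funpow_mult by (simp add: mult.commute)
qed

text \<open>Some power \<open>h\<close> of the morphism puts \<open>v\<close> into the image of
  every letter, and \<open>u\<close> is a concatenation of such images of bounded length.\<close>

lemma fixed_point_unif_recurrent:
  fixes \<phi> :: "'a::finite morph"
  assumes prim: "primitive \<phi>" and fp: "fixed_point \<phi> u" and ab: "(a::'a) \<noteq> b"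
  shows "unif_recurrent u"
  unfolding unif_recurrent_def
proof
  fix v assume "v \<in> inf_factors u"
  then obtain i where v: "v = seg u i (length v)" using inf_factors_iff by blast
  obtain k where k: "k > 0" "\<And>a b. b \<in> set ((morph_app \<phi> ^^ k) [a])"
    using prim unfolding primitive_def by blast
  define m where "m = i + length v"
  \<comment> \<open>The exponent makes the image of \<open>u 0\<close> a prefix of length at least
    \<open>2 ^ m > m\<close>, long enough to cover the chosen occurrence of
    \<open>v\<close>.\<close>
  define g where "g = morph_app \<phi> ^^ (k * m)"
  obtain l where l: "g [u 0] = seg u 0 l"
    using fixed_point_power_seg[OF fp, of "k * m" 1] by (auto simp: g_def seg_Suc)
  have "2 ^ m * length [u 0] \<le> length (g [u 0])"
    unfolding g_def by (rule primitive_growing[OF k(2) ab])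
  then have "2 ^ m \<le> l" using l by simp
  moreover have "m < 2 ^ m" by simp
  ultimately have "m \<le> l" by linarith
  then have "v \<in> factors (g [u 0])" unfolding l factors_seg using v by (auto simp: m_def)
  define h where "h w = g ((morph_app \<phi> ^^ k) w)" for w
  have h_append: "h (x @ y) = h x @ h y" for x y by (simp add: h_def g_def morph_power_append)
  have vh: "v \<in> factors (h [c])" for c
  proof -
    obtain x y where "(morph_app \<phi> ^^ k) [c] = x @ u 0 # y"
      using k(2)[of "u 0" c] by (meson split_list)
    then have "(morph_app \<phi> ^^ k) [c] = x @ [u 0] @ y" by simp
    then have "h [c] = g x @ g [u 0] @ g y" by (simp only: h_def g_def morph_power_append)
    then have "g [u 0] \<in> factors (h [c])" by (auto simp: factors_iff)
    then show ?thesis using \<open>v \<in> factors (g [u 0])\<close> factors_trans by blast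
  qed
  have h_seg: "\<exists>m. h (seg u 0 n) = seg u 0 m" for n
    unfolding h_def g_def using fixed_point_power_seg[OF fp] by metis
  define len where "len n = length (h (seg u 0 n))" for n
  have h_eq: "h (seg u 0 n) = seg u 0 (len n)" for n using h_seg[of n] by (auto simp: len_def)
  have len_Suc: "len (Suc n) = len n + length (h [u n])" for n
    by (simp add: len_def seg_snoc h_append)
  have block: "h [u n] = seg u (len n) (length (h [u n]))" for n
  proof -
    have "h (seg u 0 (Suc n)) = seg u 0 (len n) @ h [u n]" by (simp add: seg_snoc h_append h_eq)
    moreover have "h (seg u 0 (Suc n)) = seg u 0 (len n) @ seg u (len n) (length (h [u n]))"
      using seg_append[of u 0 "len n"] by (simp add: h_eq len_Suc)
    ultimately show ?thesis by simp
  qed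
  define C where "C = Max (range (\<lambda>c. length (h [c])))"
  have C: "length (h [c]) \<le> C" for c unfolding C_def by (rule Max_ge) auto
  have h1: "1 \<le> length (h [c])" for c
  proof -
    have "(morph_app \<phi> ^^ (k * m + k)) [c] = h [c]"
      unfolding h_def g_def funpow_add by simp
    then have "2 ^ Suc m * length [c] \<le> length (h [c])"
      using primitive_growing[OF k(2) ab, of "Suc m" "[c]"] by (simp add: add.commute)
    moreover have "(1::nat) \<le> 2 ^ Suc m * length [c]" by simp
    ultimately show ?thesis by (rule le_trans[rotated])
  qed
  have len_ge: "n \<le> len n" for n
  proof (induction n)
    case (Suc n)
    then show ?case using len_Suc[of n] h1[of "u n"] by simp
  qed simp
  \<comment> \<open>At most \<open>C\<close> letters to the start of the next block, and at most
    \<open>C\<close> for the block itself.\<close>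
  have "v \<in> factors (seg u i (2 * C))" for i
  proof -
    define n where "n = (LEAST n. i \<le> len n)"
    have n: "i \<le> len n" unfolding n_def by (rule LeastI[of _ i]) (rule len_ge)
    have "len n \<le> i + C"
    proof (cases n)
      case 0
      then show ?thesis by (simp add: len_def h_def g_def morph_power_Nil)
    next
      case (Suc n')
      then have "len n' < i" using not_less_Least[of n' "\<lambda>n. i \<le> len n"] by (simp add: n_def)
      then show ?thesis using Suc len_Suc[of n'] C[of "u n'"] by simp
    qed
    then have "h [u n] \<in> factors (seg u i (2 * C))"
      unfolding factors_seg using n block[of n] C[of "u n"] by (intro exI[of _ "len n"]) auto
    then show ?thesis using vh factors_trans by blast
  qed
  then show "\<exists>B. \<forall>i. v \<in> factors (seg u i B)" by blast
qed

text \<open>The conjugacies make \<open>w2\<close> a suffix of the image of any long enough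
  \<open>s\<close> and \<open>w1\<close> a prefix of that of any long enough \<open>t\<close>. So
  the image of \<open>s v t\<close> contains \<open>w2 @ morph_app \<phi> v @ w1\<close>, which is
  the desired word.\<close>

lemma conj_closed:
  assumes ur: "unif_recurrent u" and fp: "fixed_point \<phi> u" and ne: "\<And>a. \<phi> a \<noteq> []"
    and conj: "\<And>a. R a @ w2 = w2 @ \<phi> a" "\<And>a. \<phi> a @ w1 = w1 @ L a"
    and v: "v \<in> inf_factors u"
  shows "morph_app R v @ w2 @ w1 \<in> inf_factors u"
proof -
  obtain j where j: "j \<ge> length w2" "seg u j (length v) = v" using recurrent_late[OF ur v] by blast
  define s t where "s = seg u 0 j" and "t = seg u (j + length v) (length w1)"
  have "seg u 0 (j + length v + length w1) = s @ v @ t"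
    using seg_append[of u 0 "j + length v" "length w1"] seg_append[of u 0 j "length v"] j(2)
    by (simp add: s_def t_def)
  then have svt: "s @ v @ t \<in> inf_factors u" by (metis seg_in_inf_factors)
  have "length w2 \<le> length (morph_app \<phi> s)"
    using j(1) length_morph_app_le[of \<phi> s, OF ne] by (simp add: s_def)
  moreover have "morph_app R s @ w2 = w2 @ morph_app \<phi> s" by (rule morph_app_conj[OF conj(1)])
  ultimately obtain x where x: "x @ w2 = morph_app \<phi> s"
    by (auto simp: append_eq_append_conv2)
  have "length w1 \<le> length (morph_app \<phi> t)"
    using length_morph_app_le[of \<phi> t, OF ne] by (simp add: t_def)
  moreover have "take (length w1) (morph_app \<phi> t @ w1) = w1"
    using morph_app_conj[of \<phi> w1 L t, OF conj(2)] by simp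
  ultimately have "morph_app \<phi> t = w1 @ drop (length w1) (morph_app \<phi> t)"
    using append_take_drop_id[of "length w1" "morph_app \<phi> t"] by simp
  then obtain y where y: "w1 @ y = morph_app \<phi> t" by metis
  have "morph_app R v @ w2 = w2 @ morph_app \<phi> v" by (rule morph_app_conj[OF conj(1)])
  then have "x @ (morph_app R v @ w2 @ w1) @ y = (x @ w2) @ morph_app \<phi> v @ w1 @ y"
    by (metis append.assoc)
  also have "\<dots> = morph_app \<phi> (s @ v @ t)" using x y by simp
  finally have "morph_app \<phi> (s @ v @ t) = x @ (morph_app R v @ w2 @ w1) @ y" ..
  then have "morph_app R v @ w2 @ w1 \<in> factors (morph_app \<phi> (s @ v @ t))"
    unfolding factors_iff by blast
  then show ?thesis by (rule inf_factors_factor[OF _ fixed_point_closed[OF fp svt]])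
qed

text \<open>A one-letter word is its own reversal, so returns up to reversal are the ordinary
  ones.\<close>

lemma pal_returns_1:
  assumes "\<forall>a \<in> range u. \<forall>r \<in> complete_return_words_letter u a. palindrome r"
  shows "pal_returns u 1"
  unfolding pal_returns_def
proof (intro allI impI)
  fix i j assume c: "consec u i j 1"
  have s1: "seg u k 1 = [u k]" for k by (simp add: seg_def)
  have c': "i < j" "u j = u i" "\<And>k. i < k \<Longrightarrow> k < j \<Longrightarrow> u k \<noteq> u i"
    using c unfolding consec_def s1 by auto
  have "seg u i (j - i + 1) = map u [i..<Suc j]" using c'(1) by (simp add: seg_def)
  moreover have "map u [i..<Suc j] \<in> complete_return_words_letter u (u i)"
    unfolding complete_return_words_letter_def using c' by blast
  ultimately show "palindrome (seg u i (j - i + 1))" using assms by simp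
qed

theorem theorem1:
  fixes \<phi> :: "('a::finite) \<Rightarrow> 'a list" and u :: "nat \<Rightarrow> 'a"
  assumes "primitive \<phi>" and "marked \<phi>" and "fixed_point \<phi> u"
    and "defect_inf u < \<infinity>"
    and "(\<forall>a \<in> range u. \<forall>r \<in> complete_return_words_letter u a. palindrome r)
         \<or> (\<exists>\<psi>. conjugate \<psi> \<phi> \<and> \<psi> \<noteq> \<phi>)"
  shows "defect_inf u = 0"
proof (rule defect_zero_if_pal_returns, rule ccontr)
  fix n0 assume not_pal: "\<not> pal_returns u n0"
  obtain L0 R0 where L0: "left_conj L0 \<phi>" "\<not> constant_map (Fst L0)" "inj (Fst L0)"
    and R0: "left_conj \<phi> R0" "\<not> constant_map (Lst R0)" "inj (Lst R0)"
    using assms(2) unfolding marked_def is_leftmost_conj_def is_rightmost_conj_def by blast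
  obtain w1 w2 where w1: "\<And>a. \<phi> a @ w1 = w1 @ L0 a" and w2: "\<And>a. R0 a @ w2 = w2 @ \<phi> a"
    using L0(1) R0(1) unfolding left_conj_def by blast
  define w0 where "w0 = w2 @ w1"
  have conj: "R0 a @ w0 = w0 @ L0 a" for a
    unfolding w0_def using w1[of a] w2[of a] by (metis append.assoc)
  have ne: "\<phi> a \<noteq> []" for a by (rule primitive_nonerasing[OF assms(1)])
  have neR: "R0 a \<noteq> []" for a using arg_cong[OF w2[of a], of length] ne[of a] by auto
  \<comment> \<open>A non-constant map of first letters needs two letters in the alphabet.\<close>
  obtain a b :: 'a where ab: "a \<noteq> b" using L0(2) unfolding constant_map_def by metis
  have ur: "unif_recurrent u" by (rule fixed_point_unif_recurrent[OF assms(1,3) ab])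
  obtain N where N: "\<And>n. n \<ge> N \<Longrightarrow> pal_returns u n"
    using finite_defect_pal_returns[OF ur assms(4)] by blast
  have rc: "rev v \<in> inf_factors u" if "v \<in> inf_factors u" for v
    by (rule inf_factors_rev[OF ur N that])
  obtain k where k: "k > 0" "\<And>a b. b \<in> set ((morph_app \<phi> ^^ k) [a])"
    using assms(1) unfolding primitive_def by blast
  have "\<exists>R L w. marked_pair u R L w \<and> (w0 \<noteq> [] \<longrightarrow> w \<noteq> [])"
  proof (rule marked_pair_power[of R0 w0 L0 u, OF conj neR])
    show "inj (\<lambda>a. last (R0 a))" "inj (\<lambda>a. hd (L0 a))"
      using R0(3) L0(3) unfolding Lst_def[abs_def] Fst_def[abs_def] by auto
    show "morph_app R0 v @ w0 \<in> inf_factors u" if "v \<in> inf_factors u" for v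
      unfolding w0_def by (rule conj_closed[OF ur assms(3) ne w2 w1 that])
    fix v :: "'a list" and N assume vw: "v \<noteq> [] \<or> w0 \<noteq> []"
    show "\<exists>n. N \<le> length (((\<lambda>v. morph_app R0 v @ w0) ^^ n) v)"
    proof (cases "w0 = []")
      case True
      then have "R0 = \<phi>" using w2 by (auto simp: w0_def)
      then have "(\<lambda>v. morph_app R0 v @ w0) = morph_app \<phi>" using True by auto
      moreover have "N \<le> length ((morph_app \<phi> ^^ (k * N)) v)"
      proof -
        have "N < 2 ^ N" by simp
        also have "(2::nat) ^ N \<le> 2 ^ N * length v" using vw True by (cases v) auto
        also have "\<dots> \<le> length ((morph_app \<phi> ^^ (k * N)) v)" by (rule primitive_growing[OF k(2) ab])
        finally show ?thesis by simp
      qed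
      ultimately show ?thesis by metis
    next
      case False
      have "n \<le> length (((\<lambda>v. morph_app R0 v @ w0) ^^ n) v)" for n
      proof (induction n)
        case (Suc n)
        then show ?case using False length_morph_app_le[of R0, OF neR]
          by (cases w0) (auto intro: order_trans le_trans[OF _ le_add1])
      qed simp
      then show ?thesis by blast
    qed
  qed
  then obtain R L w where mp: "marked_pair u R L w" and w0w: "w0 \<noteq> [] \<Longrightarrow> w \<noteq> []" by blast
  interpret marked_pair u R L w by (fact mp)
  obtain c p l where bad: "bad_walk u c l p" and c: "pal_returns u 1 \<Longrightarrow> c \<noteq> []"
    using bad_walk_exists[OF ur not_pal] by blast
  have cw: "c \<noteq> [] \<or> w \<noteq> []"
    using assms(5)
  proof
    assume "\<forall>a \<in> range u. \<forall>r \<in> complete_return_words_letter u a. palindrome r"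
    then show ?thesis using pal_returns_1 c by blast
  next
    assume "\<exists>\<psi>. conjugate \<psi> \<phi> \<and> \<psi> \<noteq> \<phi>"
    then obtain \<psi> where \<psi>: "conjugate \<psi> \<phi>" "\<psi> \<noteq> \<phi>" by blast
    \<comment> \<open>With \<open>w0\<close> empty, the morphism is its own leftmost and rightmost
      conjugate. Another conjugate would need a nonempty conjugating word, making the first or the
      last letters of all images equal.\<close>
    have "w0 \<noteq> []"
    proof
      assume "w0 = []"
      then have eq: "L0 = \<phi>" "R0 = \<phi>" using w1 w2 by (auto simp: w0_def)
      from \<psi>(1) show False unfolding conjugate_def
      proof
        assume "left_conj \<psi> \<phi>"
        then obtain x where x: "\<And>a. \<phi> a @ x = x @ \<psi> a" unfolding left_conj_def by blast
        then have "x \<noteq> []" using \<psi>(2) by auto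
        then have "hd (\<phi> a) = hd x" for a using x[of a] ne[of a] by (metis hd_append2)
        then show False using L0(2) eq by (auto simp: constant_map_def Fst_def)
      next
        assume "left_conj \<phi> \<psi>"
        then obtain x where x: "\<And>a. \<psi> a @ x = x @ \<phi> a" unfolding left_conj_def by blast
        then have "x \<noteq> []" using \<psi>(2) by auto
        then have "last (\<phi> a) = last x" for a using x[of a] ne[of a] by (metis last_appendR)
        then show False using R0(2) eq by (auto simp: constant_map_def Lst_def)
      qed
    qed
    then show ?thesis using w0w by blast
  qed
  obtain m where m: "(morph_app \<phi> ^^ k) (seg u 0 1) = seg u 0 m"
    using fixed_point_power_seg[OF assms(3)] by blast
  then have all: "set (seg u 0 m) = UNIV" using k(2)[of _ "u 0"] by (auto simp: seg_Suc)
  obtain B where B: "\<forall>W \<in> inf_factors u. length W \<ge> B \<longrightarrow> seg u 0 m \<in> factors W"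
    using unif_recurrent_long[OF ur, of "seg u 0 m"] by auto
  have letters: "set W = UNIV" if "W \<in> inf_factors u" "B \<le> length W" for W
    using B that all by (fastforce simp: factors_iff)
  have "\<exists>n l' p'. N \<le> length ((Phi ^^ n) c) \<and> bad_walk u ((Phi ^^ n) c) l' p'"
    by (rule bad_walk_Phi[OF rc bad cw letters])
  then obtain n l' p' where "N \<le> length ((Phi ^^ n) c)" "bad_walk u ((Phi ^^ n) c) l' p'"
    by blast
  then show False using no_bad_walk[OF ur N N] by (meson le_Suc_eq)
qed

end
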